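(* Let $k\geqslant 2$, let $G$ be a $k$-player projection game, and let $\varepsilon>0$ with $\mathbf{val}(G)=1-\varepsilon$. Then there is a constant $c>0$, depending only on $\varepsilon$ and $G$, such that $\mathbf{val}(G^{\otimes n})\leqslant \exp(-c\,n)$ for every $n\geqslant 1$.
   Context: A $k$-player game $G$ consists of finite question sets $\mathcal{X}_1,\dots,\mathcal{X}_k$, finite answer sets $\mathcal{A}_1,\dots,\mathcal{A}_k$, a probability distribution $\mu$ on $\mathcal{X}_1\times\cdots\times\mathcal{X}_k$, and a predicate $V:(\mathcal{X}_1\times\cdots\times\mathcal{X}_k)\times(\mathcal{A}_1\times\cdots\times\mathcal{A}_k)\to\{0,1\}$. The verifier samples $(x^1,\dots,x^k)\sim\mu$, sends $x^i$ to player $i$, player $i$ answers $a^i=\alpha^i(x^i)$ for a function $\alpha^i:\mathcal{X}_i\to\mathcal{A}_i$ (no communication), and the verifier accepts iff $V((x^1,\dots,x^k),(a^1,\dots,a^k))=1$. The value $\mathbf{val}(G)$ is the maximum over strategies $(\alpha^1,\dots,\alpha^k)$ of the acceptance probability. The $n$-fold parallel repetition $G^{\otimes n}$ is the $k$-player game with question sets $\mathcal{X}_i^n$ and answer sets $\mathcal{A}_i^n$ in which the $n$ question tuples $(x^1_j,\dots,x^k_j)$, $j\in[n]$, are sampled independently from $\mu$, player $i$ receives $(x^i_1,\dots,x^i_n)$ and answers $(a^i_1,\dots,a^i_n)$, and the verifier accepts iff $V((x^1_j,\dots,x^k_j),(a^1_j,\dots,a^k_j))=1$ for all $j\in[n]$.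 $G$ is a projection game if for every question tuple $q=(x^1,\dots,x^k)$ there exist an integer $D_q\geqslant 1$ and maps $\sigma^i_q:\mathcal{A}_i\to[D_q]$, $i\in[k]$, such that $V(q,(a^1,\dots,a^k))=1$ iff $\sigma^i_q(a^i)=\sigma^{i'}_q(a^{i'})$ for all $i\neq i'$. *)

theory Defs
  imports "HOL-Probability.Probability"
begin

text \<open>A k-player game. Players are indexed by 0..<k. A question tuple is a list of
length k (entry i goes to player i), likewise an answer tuple.\<close>

record ('x, 'a) game =
  nplayers :: nat
  qset :: "nat \<Rightarrow> 'x set"
  aset :: "nat \<Rightarrow> 'a set"
  qdist :: "'x list pmf"
  pred :: "'x list \<Rightarrow> 'a list \<Rightarrow> bool"

definition qtuples :: "('x, 'a) game \<Rightarrow> 'x list set" where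
  "qtuples G = {q. length q = nplayers G \<and> (\<forall>i<nplayers G. q ! i \<in> qset G i)}"

definition atuples :: "('x, 'a) game \<Rightarrow> 'a list set" where
  "atuples G = {a. length a = nplayers G \<and> (\<forall>i<nplayers G. a ! i \<in> aset G i)}"

definition wf_game :: "('x, 'a) game \<Rightarrow> bool" where
  "wf_game G \<longleftrightarrow> (\<forall>i<nplayers G. finite (qset G i) \<and> finite (aset G i) \<and> aset G i \<noteq> {})
     \<and> set_pmf (qdist G) \<subseteq> qtuples G"

definition strategies :: "('x, 'a) game \<Rightarrow> (nat \<Rightarrow> 'x \<Rightarrow> 'a) set" where
  "strategies G = {\<alpha>. \<forall>i<nplayers G. \<forall>x\<in>qset G i. \<alpha> i x \<in> aset G i}"

definition win_prob :: "('x, 'a) game \<Rightarrow> (nat \<Rightarrow> 'x \<Rightarrow> 'a) \<Rightarrow> real" where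
  "win_prob G \<alpha> = measure_pmf.prob (qdist G)
     {q. pred G q (map (\<lambda>i. \<alpha> i (q ! i)) [0..<nplayers G])}"

definition val :: "('x, 'a) game \<Rightarrow> real" where
  "val G = (SUP \<alpha>\<in>strategies G. win_prob G \<alpha>)"

fun iid_pmf :: "'b pmf \<Rightarrow> nat \<Rightarrow> 'b list pmf" where
  "iid_pmf p 0 = return_pmf []"
| "iid_pmf p (Suc n) = bind_pmf p (\<lambda>q. bind_pmf (iid_pmf p n) (\<lambda>qs. return_pmf (q # qs)))"

definition par_rep :: "('x, 'a) game \<Rightarrow> nat \<Rightarrow> ('x list, 'a list) game" where
  "par_rep G n = \<lparr> nplayers = nplayers G,
     qset = (\<lambda>i. {xs. length xs = n \<and> set xs \<subseteq> qset G i}),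
     aset = (\<lambda>i. {as. length as = n \<and> set as \<subseteq> aset G i}),
     qdist = map_pmf (\<lambda>qs. map (\<lambda>i. map (\<lambda>j. qs ! j ! i) [0..<n]) [0..<nplayers G])
               (iid_pmf (qdist G) n),
     pred = (\<lambda>Q A. \<forall>j<n. pred G (map (\<lambda>i. Q ! i ! j) [0..<nplayers G])
                               (map (\<lambda>i. A ! i ! j) [0..<nplayers G])) \<rparr>"

definition projection_game :: "('x, 'a) game \<Rightarrow> bool" where
  "projection_game G \<longleftrightarrow> (\<forall>q\<in>qtuples G. \<exists>D::nat. D \<ge> 1 \<and> (\<exists>\<sigma> :: nat \<Rightarrow> 'a \<Rightarrow> nat.
      (\<forall>i<nplayers G. \<forall>a\<in>aset G i. \<sigma> i a \<in> {1..D}) \<and>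
      (\<forall>a\<in>atuples G. pred G q a \<longleftrightarrow>
          (\<forall>i<nplayers G. \<forall>i'<nplayers G. i \<noteq> i' \<longrightarrow> \<sigma> i (a ! i) = \<sigma> i' (a ! i')))))"

end

theory Submission
  imports Defs
begin

text \<open>
  Pass to the two-player projection game \<open>H\<close> in which the first player receives a whole question
  tuple \<open>q\<close> and answers with a label, while the second player receives \<open>(i, q ! i)\<close> for a uniformly
  random \<open>i\<close> and answers for player \<open>i\<close>. If \<open>G\<close> has value below 1, then so has \<open>H\<close>.

  A strategy of value \<open>v\<close> for the \<open>n\<close>-fold repetition of \<open>G\<close> gives one of value at least \<open>v ^ 2 ^ k\<close> for
  that of \<open>H\<close>. The indices \<open>i\<close> colour the coordinates; given the second player's questions, two lists
  of question tuples \<open>qs\<close> and \<open>qs'\<close> are conditionally independent, and by repeated Cauchy--Schwarz all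
  \<open>2 ^ k\<close> lists that take the coordinates of each colour from \<open>qs\<close> or from \<open>qs'\<close> are accepted with
  probability at least \<open>v ^ 2 ^ k\<close>. In that event the second player, answering from \<open>qs'\<close>, agrees with
  the labels of the accepted list \<open>qs\<close>.

  For \<open>H\<close> the argument is that of Dinur and Steurer: the collision probability of a strategy of the
  second player loses a constant factor per coordinate. Peeling off one coordinate reduces this to a
  pointwise inequality between two quadratic forms in non-negative variables, and the constant comes
  from compactness.
\<close>

section \<open>Finite weighted averages\<close>

definition avg :: "'a set \<Rightarrow> ('a \<Rightarrow> real) \<Rightarrow> ('a \<Rightarrow> real) \<Rightarrow> real" where
  "avg A p f = (\<Sum>x\<in>A. p x * f x)"

definition is_dist :: "'a set \<Rightarrow> ('a \<Rightarrow> real) \<Rightarrow> bool" where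
  "is_dist A p \<longleftrightarrow> finite A \<and> (\<forall>x\<in>A. 0 \<le> p x) \<and> sum p A = 1"

lemma avg_mono:
  assumes "is_dist A p" and "\<And>x. x \<in> A \<Longrightarrow> p x > 0 \<Longrightarrow> f x \<le> g x"
  shows "avg A p f \<le> avg A p g"
  unfolding avg_def
proof (rule sum_mono)
  fix x assume x: "x \<in> A"
  then have "p x = 0 \<or> p x > 0" using assms(1) by (force simp: is_dist_def)
  then show "p x * f x \<le> p x * g x" using assms(2)[OF x] by auto
qed

lemma avg_cong: "(\<And>x. x \<in> A \<Longrightarrow> f x = g x) \<Longrightarrow> avg A p f = avg A p g"
  unfolding avg_def by (rule sum.cong) auto

lemma avg_nonneg: "is_dist A p \<Longrightarrow> (\<And>x. x \<in> A \<Longrightarrow> 0 \<le> f x) \<Longrightarrow> 0 \<le> avg A p f"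
  unfolding avg_def is_dist_def by (intro sum_nonneg mult_nonneg_nonneg) auto

lemma avg_const: "is_dist A p \<Longrightarrow> avg A p (\<lambda>_. c) = c"
  unfolding avg_def is_dist_def by (simp add: sum_distrib_right[symmetric])

lemma avg_cmult: "avg A p (\<lambda>x. c * f x) = c * avg A p f"
  unfolding avg_def by (subst sum_distrib_left) (simp add: mult_ac)

lemma avg_mult_right: "avg A p (\<lambda>x. f x * c) = avg A p f * c"
  unfolding avg_def by (subst sum_distrib_right) (simp add: mult_ac)

lemma avg_add: "avg A p (\<lambda>x. f x + g x) = avg A p f + avg A p g"
  unfolding avg_def by (simp add: sum.distrib algebra_simps)

lemma avg_sum: "avg A p (\<lambda>x. \<Sum>y\<in>Y. f x y) = (\<Sum>y\<in>Y. avg A p (\<lambda>x. f x y))"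
  unfolding avg_def by (subst sum.swap) (simp add: sum_distrib_left)

lemma avg_swap: "avg A p (\<lambda>x. avg B q (\<lambda>y. f x y)) = avg B q (\<lambda>y. avg A p (\<lambda>x. f x y))"
  unfolding avg_def sum_distrib_left by (subst sum.swap) (simp add: mult_ac)

lemma avg_variance:
  assumes "is_dist A p"
  shows "avg A p (\<lambda>x. (f x)\<^sup>2) = (avg A p f)\<^sup>2 + avg A p (\<lambda>x. (f x - avg A p f)\<^sup>2)"
proof -
  define m where "m = avg A p f"
  have "avg A p (\<lambda>x. (f x - m)\<^sup>2) = avg A p (\<lambda>x. (f x)\<^sup>2 + ((- 2 * m) * f x + m\<^sup>2))"
    by (rule avg_cong) (simp add: power2_eq_square algebra_simps)
  also have "\<dots> = avg A p (\<lambda>x. (f x)\<^sup>2) + ((- 2 * m) * m + m\<^sup>2)"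
    by (simp only: avg_add avg_cmult avg_const[OF assms] m_def)
  finally show ?thesis unfolding m_def[symmetric] by (simp add: power2_eq_square)
qed

lemma avg_power2: "is_dist A p \<Longrightarrow> (avg A p f)\<^sup>2 \<le> avg A p (\<lambda>x. (f x)\<^sup>2)"
  using avg_variance[of A p f] avg_nonneg[of A p "\<lambda>x. (f x - avg A p f)\<^sup>2"] by simp

text \<open>Jensen's inequality for the exponent \<open>2 ^ m\<close>, by iterating
  \<open>avg_power2\<close>; non-negativity makes squaring monotone.\<close>

lemma avg_power_two_power:
  assumes "is_dist A p" and "\<And>x. x \<in> A \<Longrightarrow> 0 \<le> f x"
  shows "(avg A p f) ^ (2 ^ m) \<le> avg A p (\<lambda>x. f x ^ (2 ^ m))"
proof (induction m)
  case (Suc m)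
  have "(avg A p f) ^ (2 ^ Suc m) = ((avg A p f) ^ (2 ^ m))\<^sup>2"
    by (simp add: power_mult[symmetric] mult.commute)
  also have "\<dots> \<le> (avg A p (\<lambda>x. f x ^ (2 ^ m)))\<^sup>2"
    using Suc avg_nonneg[OF assms] by (intro power_mono) auto
  also have "\<dots> \<le> avg A p (\<lambda>x. (f x ^ (2 ^ m))\<^sup>2)"
    by (rule avg_power2[OF assms(1)])
  also have "\<dots> = avg A p (\<lambda>x. f x ^ (2 ^ Suc m))"
    by (simp add: power_mult[symmetric] mult.commute)
  finally show ?case .
qed simp

lemma avg_le_some:
  assumes "is_dist A p"
  obtains y where "y \<in> A" "avg A p f \<le> f y"
proof -
  have fin: "finite A" "A \<noteq> {}" using assms by (auto simp: is_dist_def)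
  have "Max (f ` A) \<in> f ` A" using fin by (intro Max_in) auto
  then obtain y where y: "y \<in> A" "f y = Max (f ` A)" by auto
  have "avg A p f \<le> avg A p (\<lambda>_. f y)"
    by (rule avg_mono[OF assms]) (use fin y in auto)
  with y show ?thesis using that avg_const[OF assms] by metis
qed

section \<open>Product distributions on words of fixed length\<close>

definition words :: "'a set \<Rightarrow> nat \<Rightarrow> 'a list set" where
  "words S n = {xs. set xs \<subseteq> S \<and> length xs = n}"

definition weight :: "('a \<Rightarrow> real) list \<Rightarrow> 'a list \<Rightarrow> real" where
  "weight ps xs = prod_list (map2 (\<lambda>p x. p x) ps xs)"

text \<open>The weights may vary from coordinate to coordinate, because conditioning on the second
  player's questions turns an i.i.d. list into a product of different laws.\<close>

definition Avg :: "'a set \<Rightarrow> ('a \<Rightarrow> real) list \<Rightarrow> ('a list \<Rightarrow> real) \<Rightarrow> real" where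
  "Avg S ps = avg (words S (length ps)) (weight ps)"

lemma weight_Nil [simp]: "weight [] xs = 1"
  and weight_Cons [simp]: "weight (p # ps) (x # xs) = p x * weight ps xs"
  by (simp_all add: weight_def)

lemma words_0 [simp]: "words S 0 = {[]}"
  by (auto simp: words_def)

lemma words_Suc: "words S (Suc n) = (\<lambda>(x, xs). x # xs) ` (S \<times> words S n)"
  by (auto simp: words_def length_Suc_conv image_iff)

lemma Cons_in_words [simp]: "x # xs \<in> words S (Suc n) \<longleftrightarrow> x \<in> S \<and> xs \<in> words S n"
  by (auto simp: words_def)

lemma finite_words [simp]: "finite S \<Longrightarrow> finite (words S n)"
  by (simp add: words_def finite_lists_length_eq)

lemma length_words: "xs \<in> words S n \<Longrightarrow> length xs = n"
  by (simp add: words_def)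

lemma nth_words: "xs \<in> words S n \<Longrightarrow> j < n \<Longrightarrow> xs ! j \<in> S"
  by (auto simp: words_def)

lemma words_nthI: "length xs = n \<Longrightarrow> (\<And>j. j < n \<Longrightarrow> xs ! j \<in> S) \<Longrightarrow> xs \<in> words S n"
  by (auto simp: words_def in_set_conv_nth)

lemma sum_words_Suc: "(\<Sum>xs\<in>words S (Suc n). f xs) = (\<Sum>x\<in>S. \<Sum>xs\<in>words S n. f (x # xs))"
proof -
  have "inj_on (\<lambda>(x, xs). x # xs) (S \<times> words S n)" by (auto simp: inj_on_def)
  then have "(\<Sum>xs\<in>words S (Suc n). f xs) = (\<Sum>z\<in>S \<times> words S n. f ((\<lambda>(x, xs). x # xs) z))"
    unfolding words_Suc by (simp add: sum.reindex o_def)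
  then show ?thesis by (simp add: sum.cartesian_product case_prod_unfold)
qed

lemma Avg_Nil [simp]: "Avg S [] f = f []"
  by (simp add: Avg_def avg_def)

lemma Avg_Cons [simp]: "Avg S (p # ps) f = avg S p (\<lambda>x. Avg S ps (\<lambda>xs. f (x # xs)))"
  unfolding Avg_def avg_def by (simp add: sum_words_Suc sum_distrib_left mult.assoc)

lemma is_dist_words:
  assumes "finite S" "\<forall>p\<in>set ps. is_dist S p"
  shows "is_dist (words S (length ps)) (weight ps)"
  using assms(2)
proof (induction ps)
  case (Cons p ps)
  then have p: "is_dist S p" and ps: "is_dist (words S (length ps)) (weight ps)" by auto
  have "(\<Sum>xs\<in>words S (Suc (length ps)). weight (p # ps) xs) = 1"
    unfolding sum_words_Suc weight_Cons using p ps
    by (simp add: is_dist_def flip: sum_distrib_left)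
  moreover have "\<forall>xs\<in>words S (Suc (length ps)). 0 \<le> weight (p # ps) xs"
    using p ps by (auto simp: words_Suc is_dist_def)
  ultimately show ?case using assms(1) by (simp add: is_dist_def)
qed (simp add: is_dist_def)

lemma weight_nonzero_nth:
  assumes "weight ps xs \<noteq> 0" "length xs = length ps" "j < length ps"
  shows "(ps ! j) (xs ! j) \<noteq> 0"
proof -
  have "(ps ! j) (xs ! j) \<in> set (map2 (\<lambda>p x. p x) ps xs)"
    using assms by (force simp: in_set_conv_nth)
  then show ?thesis using assms(1) unfolding weight_def prod_list_zero_iff by metis
qed

section \<open>Mixed words and the box inequality\<close>

definition mix :: "'i set \<Rightarrow> 'i list \<Rightarrow> 'a list \<Rightarrow> 'a list \<Rightarrow> 'a list" where
  "mix T is xs ys = map (\<lambda>(i, x, y). if i \<in> T then y else x) (zip is (zip xs ys))"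

lemma mix_simps [simp]:
  "mix T [] xs ys = []"
  "mix T (i # is) (x # xs) (y # ys) = (if i \<in> T then y else x) # mix T is xs ys"
  by (simp_all add: mix_def)

lemma length_mix [simp]:
  "length xs = length is \<Longrightarrow> length ys = length is \<Longrightarrow> length (mix T is xs ys) = length is"
  by (simp add: mix_def)

lemma nth_mix [simp]:
  "length xs = length is \<Longrightarrow> length ys = length is \<Longrightarrow> j < length is \<Longrightarrow>
    mix T is xs ys ! j = (if is ! j \<in> T then ys ! j else xs ! j)"
  by (simp add: mix_def)

text \<open>Every coordinate of the mixture reads exactly one of two independent samples with the
  same law, and the other one integrates out.\<close>

lemma Avg_mix:
  assumes "\<forall>p\<in>set ps. is_dist S p" "length is = length ps"
  shows "Avg S ps (\<lambda>xs. Avg S ps (\<lambda>ys. f (mix T is xs ys))) = Avg S ps f"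
  using assms
proof (induction ps arbitrary: "is" f)
  case (Cons p ps)
  then obtain i is' where is_eq: "is = i # is'" and len: "length is' = length ps"
    by (cases "is") auto
  have p: "is_dist S p" using Cons.prems by auto
  have IH: "Avg S ps (\<lambda>xs. Avg S ps (\<lambda>ys. g (mix T is' xs ys))) = Avg S ps g" for g
    using Cons.IH[of is' g] Cons.prems len by simp
  have "Avg S (p # ps) (\<lambda>xs. Avg S (p # ps) (\<lambda>ys. f (mix T is xs ys))) =
    avg S p (\<lambda>x. avg S p (\<lambda>y. Avg S ps (\<lambda>xs. Avg S ps (\<lambda>ys.
      f ((if i \<in> T then y else x) # mix T is' xs ys)))))"
    unfolding is_eq Avg_Cons mix_simps unfolding Avg_def by (intro avg_cong avg_swap)
  also have "\<dots> = avg S p (\<lambda>x. avg S p (\<lambda>y. Avg S ps (\<lambda>xs. f ((if i \<in> T then y else x) # xs))))"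
    by (subst IH) simp
  also have "\<dots> = Avg S (p # ps) f"
    using p by (cases "i \<in> T") (simp_all add: avg_const)
  finally show ?case .
qed simp

text \<open>A Cauchy-Schwarz argument as for Gowers box norms, one colour at a time: redraw the
  coordinates of the new colour, square, and apply the induction hypothesis with the two redrawn
  lists fixed.\<close>

lemma Avg_box:
  assumes fin: "finite S" and dist: "\<forall>p\<in>set ps. is_dist S p" and len: "length is = length ps"
    and T: "finite T" and f: "\<And>xs. 0 \<le> f xs"
  shows "(Avg S ps f) ^ (2 ^ card T)
    \<le> Avg S ps (\<lambda>xs. Avg S ps (\<lambda>ys. \<Prod>R\<in>Pow T. f (mix R is xs ys)))"
  using T f
proof (induction T arbitrary: f rule: finite_induct)
  case empty
  have "Avg S ps f = Avg S ps (\<lambda>xs. Avg S ps (\<lambda>ys. f (mix {} is xs ys)))"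
    by (rule Avg_mix[OF dist len, symmetric])
  then show ?case by simp
next
  case (insert l T)
  have D: "is_dist (words S (length ps)) (weight ps)"
    by (rule is_dist_words[OF fin dist])
  have nn: "0 \<le> Avg S ps g" if "\<And>x. 0 \<le> g x" for g
    unfolding Avg_def by (rule avg_nonneg[OF D that])
  \<comment> \<open>Squaring creates two independent copies \<open>as\<close> and \<open>as'\<close>
    of the redrawn list; \<open>h as as'\<close> is the function passed to the induction
    hypothesis.\<close>
  define h where "h as as' xs = f (mix {l} is xs as) * f (mix {l} is xs as')" for as as' xs
  define \<Phi> where "\<Phi> xs ys = (\<Prod>R\<in>Pow (insert l T). f (mix R is xs ys))" for xs ys
  have h0: "0 \<le> h as as' xs" for as as' xs using insert.prems by (simp add: h_def)
  \<comment> \<open>Only coordinates of colour \<open>l\<close> read \<open>as\<close> or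
    \<open>as'\<close>. Since \<open>l\<close> is not in \<open>T\<close>, the two factors of
    \<open>h\<close> correspond to \<open>R\<close> and \<open>insert l R\<close>, and together
    these exhaust \<open>Pow (insert l T)\<close>.\<close>
  have prod_eq: "(\<Prod>R\<in>Pow T. h as as' (mix R is xs ys))
      = \<Phi> (mix {l} is xs as) (mix {l} is ys as')"
    if "xs \<in> words S (length ps)" "ys \<in> words S (length ps)"
       "as \<in> words S (length ps)" "as' \<in> words S (length ps)" for xs ys as as'
  proof -
    note lw = that[THEN length_words] len
    have 1: "mix {l} is (mix R is xs ys) as = mix R is (mix {l} is xs as) (mix {l} is ys as')"
      if "R \<in> Pow T" for R
      using that insert.hyps(2) lw by (intro nth_equalityI) auto
    have 2: "mix {l} is (mix R is xs ys) as' = mix (insert l R) is (mix {l} is xs as) (mix {l} is ys as')"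
      if "R \<in> Pow T" for R
      using that insert.hyps(2) lw by (intro nth_equalityI) auto
    have "\<Phi> x y = (\<Prod>R\<in>Pow T. f (mix R is x y)) * (\<Prod>R\<in>Pow T. f (mix (insert l R) is x y))" for x y
    proof -
      have "Pow T \<inter> insert l ` Pow T = {}" and "inj_on (insert l) (Pow T)"
        using insert.hyps(2) by (auto simp: inj_on_def)
      then show ?thesis
        unfolding \<Phi>_def Pow_insert using insert.hyps(1)
        by (subst prod.union_disjoint) (simp_all add: prod.reindex)
    qed
    then show ?thesis unfolding h_def prod.distrib using 1 2 by simp
  qed
  have "(Avg S ps f) ^ (2 ^ card (insert l T)) = ((Avg S ps f)\<^sup>2) ^ (2 ^ card T)"
    using insert.hyps by (simp add: power_mult[symmetric])
  also have "\<dots> = ((Avg S ps (\<lambda>xs. Avg S ps (\<lambda>as. f (mix {l} is xs as))))\<^sup>2) ^ (2 ^ card T)"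
    by (simp only: Avg_mix[OF dist len])
  also have "\<dots> \<le> (Avg S ps (\<lambda>xs. (Avg S ps (\<lambda>as. f (mix {l} is xs as)))\<^sup>2)) ^ (2 ^ card T)"
    unfolding Avg_def by (intro power_mono avg_power2[OF D]) auto
  also have "Avg S ps (\<lambda>xs. (Avg S ps (\<lambda>as. f (mix {l} is xs as)))\<^sup>2)
      = Avg S ps (\<lambda>xs. Avg S ps (\<lambda>as. Avg S ps (\<lambda>as'. h as as' xs)))"
    unfolding Avg_def h_def power2_eq_square avg_cmult avg_mult_right ..
  also have "\<dots> = Avg S ps (\<lambda>as. Avg S ps (\<lambda>as'. Avg S ps (h as as')))"
    unfolding Avg_def
    by (subst avg_swap) (rule avg_cong, rule avg_swap)
  also have "\<dots> ^ (2 ^ card T)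
      \<le> Avg S ps (\<lambda>as. (Avg S ps (\<lambda>as'. Avg S ps (h as as'))) ^ (2 ^ card T))"
    by (subst (1 2) Avg_def) (intro avg_power_two_power[OF D] nn h0)
  also have "\<dots> \<le> Avg S ps (\<lambda>as. Avg S ps (\<lambda>as'. Avg S ps (h as as') ^ (2 ^ card T)))"
    by (subst (1 4) Avg_def, rule avg_mono[OF D], subst (1 3) Avg_def)
      (intro avg_power_two_power[OF D] nn h0)
  also have "\<dots> \<le> Avg S ps (\<lambda>as. Avg S ps (\<lambda>as'. Avg S ps (\<lambda>xs. Avg S ps (\<lambda>ys.
      \<Prod>R\<in>Pow T. h as as' (mix R is xs ys)))))"
    by (subst (1 4) Avg_def, rule avg_mono[OF D], subst (1 3) Avg_def, rule avg_mono[OF D])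
      (rule insert.IH[OF h0])
  also have "\<dots> = Avg S ps (\<lambda>as. Avg S ps (\<lambda>as'. Avg S ps (\<lambda>xs. Avg S ps (\<lambda>ys.
      \<Phi> (mix {l} is xs as) (mix {l} is ys as')))))"
    unfolding Avg_def by (intro avg_cong) (rule prod_eq)
  \<comment> \<open>Regrouping brings \<open>xs\<close> next to \<open>as\<close> and
    \<open>ys\<close> next to \<open>as'\<close>; each pair occurs only through its mixture, which
    \<open>Avg_mix\<close> replaces by a single sample.\<close>
  also have "\<dots> = Avg S ps (\<lambda>xs. Avg S ps (\<lambda>as. Avg S ps (\<lambda>ys. Avg S ps (\<lambda>as'.
      \<Phi> (mix {l} is xs as) (mix {l} is ys as')))))"
  proof -
    let ?A = "avg (words S (length ps)) (weight ps)"
    have "?A (\<lambda>as. ?A (\<lambda>as'. ?A (\<lambda>xs. ?A (\<lambda>ys. g xs as ys as'))))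
      = ?A (\<lambda>xs. ?A (\<lambda>as. ?A (\<lambda>ys. ?A (\<lambda>as'. g xs as ys as'))))" for g
    proof -
      have "?A (\<lambda>as. ?A (\<lambda>as'. ?A (\<lambda>xs. ?A (\<lambda>ys. g xs as ys as'))))
         = ?A (\<lambda>as. ?A (\<lambda>xs. ?A (\<lambda>as'. ?A (\<lambda>ys. g xs as ys as'))))"
        by (intro avg_cong avg_swap)
      also have "\<dots> = ?A (\<lambda>as. ?A (\<lambda>xs. ?A (\<lambda>ys. ?A (\<lambda>as'. g xs as ys as'))))"
        by (intro avg_cong avg_swap)
      also have "\<dots> = ?A (\<lambda>xs. ?A (\<lambda>as. ?A (\<lambda>ys. ?A (\<lambda>as'. g xs as ys as'))))"
        by (rule avg_swap)
      finally show ?thesis .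
    qed
    then show ?thesis unfolding Avg_def .
  qed
  also have "\<dots> = Avg S ps (\<lambda>xs. Avg S ps (\<lambda>as. Avg S ps (\<Phi> (mix {l} is xs as))))"
    by (subst Avg_mix[OF dist len]) simp
  also have "\<dots> = Avg S ps (\<lambda>xs. Avg S ps (\<lambda>ys. \<Phi> xs ys))"
    by (rule Avg_mix[OF dist len, of "\<lambda>xs. Avg S ps (\<Phi> xs)"])
  finally show ?case unfolding \<Phi>_def .
qed

section \<open>Collision probability of a two-player projection game\<close>

text \<open>Tychonoff's theorem; the functions are total, so their values off \<open>Z\<close> are
  pinned to 0 to keep the set compact.\<close>

lemma compact_box_functions:
  fixes Z :: "'z set" and u :: real
  shows "compact {F :: 'z \<Rightarrow> real. (\<forall>z\<in>Z. F z \<in> {0..u}) \<and> (\<forall>z. z \<notin> Z \<longrightarrow> F z = 0)}"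
proof -
  have "compactin (product_topology (\<lambda>_. euclidean) UNIV)
      (PiE UNIV (\<lambda>z. if z \<in> Z then {0..u} else {0::real}))"
    by (subst compactin_PiE) auto
  moreover have "PiE UNIV (\<lambda>z. if z \<in> Z then {0..u} else {0::real}) =
      {F. (\<forall>z\<in>Z. F z \<in> {0..u}) \<and> (\<forall>z. z \<notin> Z \<longrightarrow> F z = 0)}"
    by (auto simp: PiE_iff split: if_splits)
  ultimately show ?thesis
    by (simp add: euclidean_product_topology)
qed

lemma sum_power2_le:
  fixes f :: "'c \<Rightarrow> real"
  assumes "finite A" "\<And>x. x \<in> A \<Longrightarrow> 0 \<le> f x"
  shows "(\<Sum>x\<in>A. (f x)\<^sup>2) \<le> (sum f A)\<^sup>2"
proof -
  have "(\<Sum>x\<in>A. (f x)\<^sup>2) \<le> (\<Sum>x\<in>A. f x * sum f A)"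
    using assms by (intro sum_mono)
      (auto simp: power2_eq_square intro!: mult_left_mono member_le_sum)
  then show ?thesis by (simp add: power2_eq_square sum_distrib_right)
qed

text \<open>The game \<open>H\<close>: \<open>Q\<close> holds the first player's questions,
  \<open>leaf q i\<close> is the question to the second player, who answers in \<open>B\<close>, and
  \<open>D\<close> contains the labels. With strictly positive weights, a zero average of
  non-negative terms forces every term to vanish.\<close>

locale projection_system =
  fixes Q :: "'q set" and I :: "'i set" and B :: "'b set" and D :: "'d set"
    and \<mu> :: "'q \<Rightarrow> real" and \<nu> :: "'i \<Rightarrow> real"
    and leaf :: "'q \<Rightarrow> 'i \<Rightarrow> 'w" and proj :: "'q \<Rightarrow> 'i \<Rightarrow> 'b \<Rightarrow> 'd"
  assumes dist_Q: "is_dist Q \<mu>" and dist_I: "is_dist I \<nu>"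
    and pos_Q: "q \<in> Q \<Longrightarrow> 0 < \<mu> q" and pos_I: "i \<in> I \<Longrightarrow> 0 < \<nu> i"
    and finite_B: "finite B" and B_nonempty: "B \<noteq> {}" and finite_D: "finite D"
    and proj_in: "q \<in> Q \<Longrightarrow> i \<in> I \<Longrightarrow> b \<in> B \<Longrightarrow> proj q i b \<in> D"
begin

definition W :: "'w set" where
  "W = (\<lambda>(q, i). leaf q i) ` (Q \<times> I)"

text \<open>Here \<open>F\<close> is a fractional strategy of the second player. It is unnormalised,
  since in the repeated game it records a single outcome of the remaining coordinates.\<close>

definition mass :: "('w \<Rightarrow> 'b \<Rightarrow> real) \<Rightarrow> 'w \<Rightarrow> real" where
  "mass F w = (\<Sum>b\<in>B. F w b)"

definition vote :: "('w \<Rightarrow> 'b \<Rightarrow> real) \<Rightarrow> 'q \<Rightarrow> 'd \<Rightarrow> real" where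
  "vote F q c = avg I \<nu> (\<lambda>i. \<Sum>b\<in>{b\<in>B. proj q i b = c}. F (leaf q i) b)"

text \<open>For normalised \<open>F\<close> this is the chance that two independent choices of index
  and answer lead to the same label.\<close>

definition collision :: "('w \<Rightarrow> 'b \<Rightarrow> real) \<Rightarrow> real" where
  "collision F = avg Q \<mu> (\<lambda>q. \<Sum>c\<in>D. (vote F q c)\<^sup>2)"

definition satisfies :: "('w \<Rightarrow> 'b) \<Rightarrow> 'q \<Rightarrow> bool" where
  "satisfies \<beta> q \<longleftrightarrow> (\<forall>i\<in>I. \<forall>i'\<in>I. proj q i (\<beta> (leaf q i)) = proj q i' (\<beta> (leaf q i')))"

lemma finite_Q: "finite Q" and finite_I: "finite I" and I_nonempty: "I \<noteq> {}"
  using dist_Q dist_I by (auto simp: is_dist_def)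

lemma finite_W: "finite W"
  unfolding W_def using finite_Q finite_I by simp

lemma leaf_in_W: "q \<in> Q \<Longrightarrow> i \<in> I \<Longrightarrow> leaf q i \<in> W"
  unfolding W_def by force

lemma sum_leaf_indicator:
  assumes "q \<in> Q" "i \<in> I"
  shows "(\<Sum>w\<in>W. of_bool (leaf q i = w) * h w) = (h (leaf q i) :: real)"
proof -
  have "(\<Sum>w\<in>W. of_bool (leaf q i = w) * h w) = (\<Sum>w\<in>W. if leaf q i = w then h w else 0)"
    by (intro sum.cong) auto
  then show ?thesis using finite_W leaf_in_W[OF assms] by simp
qed

text \<open>These are the unions of connected components of the graph on \<open>W\<close> that joins
  the leaves of a common \<open>q\<close>.\<close>

definition closed_set :: "'w set \<Rightarrow> bool" where
  "closed_set C \<longleftrightarrow> C \<subseteq> W \<and> (\<forall>q\<in>Q. (\<forall>i\<in>I. leaf q i \<in> C) \<or> (\<forall>i\<in>I. leaf q i \<notin> C))"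

definition good_set :: "'w set \<Rightarrow> bool" where
  "good_set C \<longleftrightarrow> closed_set C \<and>
    (\<exists>\<beta>. (\<forall>w. \<beta> w \<in> B) \<and> (\<forall>q\<in>Q. (\<forall>i\<in>I. leaf q i \<in> C) \<longrightarrow> satisfies \<beta> q))"

definition leaf_weight :: "'w \<Rightarrow> real" where
  "leaf_weight w = avg Q \<mu> (\<lambda>q. avg I \<nu> (\<lambda>i. of_bool (leaf q i = w)))"

lemma avg_leaf: "avg Q \<mu> (\<lambda>q. avg I \<nu> (\<lambda>i. h (leaf q i))) = (\<Sum>w\<in>W. leaf_weight w * h w)"
proof -
  have "(\<Sum>w\<in>W. leaf_weight w * h w)
      = avg Q \<mu> (\<lambda>q. avg I \<nu> (\<lambda>i. \<Sum>w\<in>W. of_bool (leaf q i = w) * h w))"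
    unfolding leaf_weight_def by (simp add: avg_sum avg_mult_right)
  also have "\<dots> = avg Q \<mu> (\<lambda>q. avg I \<nu> (\<lambda>i. h (leaf q i)))"
    by (intro avg_cong sum_leaf_indicator)
  finally show ?thesis ..
qed

lemma leaf_weight_nonneg: "0 \<le> leaf_weight w"
  unfolding leaf_weight_def by (intro avg_nonneg dist_Q dist_I) auto

lemma sum_leaf_weight: "sum leaf_weight W = 1"
  using avg_leaf[of "\<lambda>_. 1"] by (simp add: avg_const dist_Q dist_I)

lemma leaf_weight_pos:
  assumes "w \<in> W"
  shows "0 < leaf_weight w"
proof -
  obtain q i where qi: "q \<in> Q" "i \<in> I" "w = leaf q i" using assms by (auto simp: W_def)
  have "0 < \<nu> i * of_bool (leaf q i = w)" using qi pos_I by simp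
  also have "\<dots> \<le> avg I \<nu> (\<lambda>i. of_bool (leaf q i = w))"
    unfolding avg_def using qi finite_I pos_I
    by (intro member_le_sum[of _ _ "\<lambda>i. \<nu> i * of_bool (leaf q i = w)"]) (auto simp: less_imp_le)
  finally have "0 < \<mu> q * avg I \<nu> (\<lambda>i. of_bool (leaf q i = w))" using pos_Q qi by simp
  also have "\<dots> \<le> leaf_weight w"
    unfolding leaf_weight_def avg_def[of Q] using qi finite_Q pos_Q
    by (intro member_le_sum[of _ _ "\<lambda>q. \<mu> q * avg I \<nu> (\<lambda>i. of_bool (leaf q i = w))"])
      (auto simp: less_imp_le intro!: mult_nonneg_nonneg avg_nonneg dist_I)
  finally show ?thesis .
qed

section \<open>The deficit of a fractional strategy\<close>

definition deficit :: "('w \<Rightarrow> 'b \<Rightarrow> real) \<Rightarrow> 'q \<Rightarrow> real" where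
  "deficit F q = avg I \<nu> (\<lambda>i. (mass F (leaf q i))\<^sup>2) - (\<Sum>c\<in>D. (vote F q c)\<^sup>2)"

lemma sum_vote:
  assumes "q \<in> Q"
  shows "(\<Sum>c\<in>D. vote F q c) = avg I \<nu> (\<lambda>i. mass F (leaf q i))"
proof -
  have "(\<Sum>c\<in>D. vote F q c)
      = avg I \<nu> (\<lambda>i. \<Sum>c\<in>D. \<Sum>b\<in>{b\<in>B. proj q i b = c}. F (leaf q i) b)"
    unfolding vote_def by (simp add: avg_sum)
  also have "\<dots> = avg I \<nu> (\<lambda>i. mass F (leaf q i))"
    unfolding mass_def
    by (intro avg_cong sum.group finite_B finite_D) (use assms proj_in in auto)
  finally show ?thesis .
qed

lemma vote_nonneg: "(\<And>w b. 0 \<le> F w b) \<Longrightarrow> 0 \<le> vote F q c"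
  unfolding vote_def by (intro avg_nonneg dist_I sum_nonneg)

text \<open>The votes sum to the mean mass \<open>m\<close>, so the variance identity splits the
  deficit into a variance and the cross terms of distinct labels. Both are non-negative when
  \<open>F\<close> is.\<close>

lemma deficit_eq:
  fixes F
  assumes "q \<in> Q"
  defines "m \<equiv> avg I \<nu> (\<lambda>i. mass F (leaf q i))"
  shows "deficit F q = avg I \<nu> (\<lambda>i. (mass F (leaf q i) - m)\<^sup>2)
    + ((\<Sum>c\<in>D. vote F q c)\<^sup>2 - (\<Sum>c\<in>D. (vote F q c)\<^sup>2))"
  unfolding deficit_def sum_vote[OF assms(1)] m_def by (subst avg_variance[OF dist_I]) simp

lemma deficit_nonneg:
  assumes "q \<in> Q" "\<And>w b. 0 \<le> F w b"
  shows "0 \<le> deficit F q"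
  unfolding deficit_eq[OF assms(1)]
  using sum_power2_le[of D "vote F q"] finite_D vote_nonneg[of F, OF assms(2)]
    avg_nonneg[OF dist_I, of "\<lambda>i. (mass F (leaf q i) - avg I \<nu> (\<lambda>i. mass F (leaf q i)))\<^sup>2"]
  by simp

lemma deficit_eq_0_mass:
  assumes "q \<in> Q" "\<And>w b. 0 \<le> F w b" "deficit F q = 0" "i \<in> I" "i' \<in> I"
  shows "mass F (leaf q i) = mass F (leaf q i')"
proof -
  define m where "m = avg I \<nu> (\<lambda>i. mass F (leaf q i))"
  have "avg I \<nu> (\<lambda>i. (mass F (leaf q i) - m)\<^sup>2) = 0"
    using assms(3) sum_power2_le[of D "vote F q"] finite_D vote_nonneg[of F, OF assms(2)]
      avg_nonneg[OF dist_I, of "\<lambda>i. (mass F (leaf q i) - m)\<^sup>2"]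
    unfolding deficit_eq[OF assms(1)] m_def by simp
  then have "\<forall>i\<in>I. \<nu> i * (mass F (leaf q i) - m)\<^sup>2 = 0"
    unfolding avg_def using finite_I pos_I by (subst (asm) sum_nonneg_eq_0_iff) (auto simp: less_imp_le)
  then have "mass F (leaf q j) = m" if "j \<in> I" for j using pos_I that by fastforce
  then show ?thesis using assms by simp
qed

text \<open>If two labels both received votes, their cross term would make the deficit
  positive.\<close>

lemma deficit_eq_0_proj:
  assumes "q \<in> Q" "\<And>w b. 0 \<le> F w b" "deficit F q = 0" "i \<in> I" "i' \<in> I" "b \<in> B" "b' \<in> B"
    and "0 < F (leaf q i) b" "0 < F (leaf q i') b'"
  shows "proj q i b = proj q i' b'"
proof (rule ccontr)
  define c c' where "c = proj q i b" and "c' = proj q i' b'"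
  assume "proj q i b \<noteq> proj q i' b'"
  then have ne: "c \<noteq> c'" by (simp add: c_def c'_def)
  have cD: "c \<in> D" "c' \<in> D" using assms proj_in by (auto simp: c_def c'_def)
  have vote_pos: "0 < vote F q (proj q j a)" if "j \<in> I" "a \<in> B" "0 < F (leaf q j) a" for j a
  proof -
    have "F (leaf q j) a \<le> (\<Sum>b\<in>{b\<in>B. proj q j b = proj q j a}. F (leaf q j) b)"
      using that assms(2) finite_B by (intro member_le_sum) auto
    then have "0 < \<nu> j * (\<Sum>b\<in>{b\<in>B. proj q j b = proj q j a}. F (leaf q j) b)"
      using that pos_I by (intro mult_pos_pos) auto
    also have "\<dots> \<le> vote F q (proj q j a)"
      unfolding vote_def avg_def using that finite_I pos_I assms(2)
      by (intro member_le_sum[of _ _ "\<lambda>i. \<nu> i * (\<Sum>b\<in>{b\<in>B. proj q i b = proj q j a}. F (leaf q i) b)"])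
        (auto simp: less_imp_le intro!: mult_nonneg_nonneg sum_nonneg)
    finally show ?thesis .
  qed
  have nn: "0 \<le> vote F q x" for x by (rule vote_nonneg[OF assms(2)])
  have "(\<Sum>c\<in>D. vote F q c)\<^sup>2 - (\<Sum>c\<in>D. (vote F q c)\<^sup>2) \<le> 0"
    using assms(3) avg_nonneg[OF dist_I, of "\<lambda>i. (mass F (leaf q i) - avg I \<nu> (\<lambda>i. mass F (leaf q i)))\<^sup>2"]
    unfolding deficit_eq[OF assms(1)] by simp
  moreover have "(\<Sum>c\<in>D. vote F q c)\<^sup>2 = (\<Sum>x\<in>D. vote F q x * (\<Sum>c\<in>D. vote F q c))"
    by (simp add: power2_eq_square sum_distrib_right)
  moreover have "(\<Sum>x\<in>D. (vote F q x)\<^sup>2) < (\<Sum>x\<in>D. vote F q x * (\<Sum>c\<in>D. vote F q c))"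
  proof (rule sum_strict_mono_ex1[OF finite_D])
    show "\<forall>x\<in>D. (vote F q x)\<^sup>2 \<le> vote F q x * (\<Sum>c\<in>D. vote F q c)"
      using nn finite_D by (auto simp: power2_eq_square intro!: mult_left_mono member_le_sum)
    have "vote F q c < vote F q c + vote F q c'" 
      using vote_pos[of i' b'] assms by (simp add: c'_def)
    also have "\<dots> = (\<Sum>x\<in>{c, c'}. vote F q x)" using ne by simp
    also have "\<dots> \<le> (\<Sum>x\<in>D. vote F q x)" using cD finite_D nn by (intro sum_mono2) auto
    finally show "\<exists>x\<in>D. (vote F q x)\<^sup>2 < vote F q x * (\<Sum>c\<in>D. vote F q c)"
      using cD vote_pos[of i b] assms
      by (intro bexI[of _ c]) (auto simp: power2_eq_square c_def intro!: mult_strict_left_mono)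
  qed
  ultimately show False by simp
qed

text \<open>The first term of the deficit sees only one leaf at a time, so its average over
  \<open>q\<close> is a diagonal form in the masses.\<close>

lemma avg_deficit: "avg Q \<mu> (deficit F) = (\<Sum>w\<in>W. leaf_weight w * (mass F w)\<^sup>2) - collision F"
proof -
  have "avg Q \<mu> (deficit F) + collision F = avg Q \<mu> (\<lambda>q. avg I \<nu> (\<lambda>i. (mass F (leaf q i))\<^sup>2))"
    unfolding collision_def deficit_def by (subst avg_add[symmetric]) simp
  then show ?thesis by (simp add: avg_leaf[of "\<lambda>w. (mass F w)\<^sup>2"])
qed

text \<open>Equal masses make the support a union of components. On it any choice of answers of
  positive weight satisfies every \<open>q\<close>, as all of them vote for one label. The support
  is disjoint from \<open>U\<close>, so the two assignments can be glued.\<close>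

lemma deficit_zero_good_extension:
  assumes U: "good_set U" and nn: "\<And>w b. 0 \<le> F w b"
    and zero: "\<And>q. q \<in> Q \<Longrightarrow> deficit F q = 0" and supp: "\<And>w b. w \<notin> W - U \<Longrightarrow> F w b = 0"
  shows "good_set (U \<union> {w. 0 < mass F w})"
proof -
  define P where "P = {w. 0 < mass F w}"
  have P_sub: "P \<subseteq> W - U"
  proof
    fix w assume "w \<in> P"
    then have "mass F w \<noteq> 0" by (simp add: P_def)
    then show "w \<in> W - U" using supp[of w] by (cases "w \<in> W - U") (auto simp: mass_def)
  qed
  obtain \<beta> where \<beta>: "\<forall>w. \<beta> w \<in> B" "\<And>q. q \<in> Q \<Longrightarrow> \<forall>i\<in>I. leaf q i \<in> U \<Longrightarrow> satisfies \<beta> q"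
    using U by (auto simp: good_set_def)
  have Ucl: "\<And>q. q \<in> Q \<Longrightarrow> (\<forall>i\<in>I. leaf q i \<in> U) \<or> (\<forall>i\<in>I. leaf q i \<notin> U)" "U \<subseteq> W"
    using U by (auto simp: good_set_def closed_set_def)
  have Pcl: "(\<forall>i\<in>I. leaf q i \<in> P) \<or> (\<forall>i\<in>I. leaf q i \<notin> P)" if "q \<in> Q" for q
  proof -
    have "mass F (leaf q i) = mass F (leaf q i')" if "i \<in> I" "i' \<in> I" for i i'
      by (rule deficit_eq_0_mass[OF \<open>q \<in> Q\<close> nn zero[OF \<open>q \<in> Q\<close>] that])
    then show ?thesis unfolding P_def mem_Collect_eq by metis
  qed
  have "\<exists>b\<in>B. 0 < F w b" if "w \<in> P" for w
  proof (rule ccontr)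
    assume "\<not> (\<exists>b\<in>B. 0 < F w b)"
    then have "mass F w = 0" unfolding mass_def by (meson nn not_less order_antisym sum.neutral)
    then show False using that by (simp add: P_def)
  qed
  then obtain \<gamma> where \<gamma>: "\<And>w. w \<in> P \<Longrightarrow> \<gamma> w \<in> B \<and> 0 < F w (\<gamma> w)" by metis
  define \<beta>' where "\<beta>' w = (if w \<in> P then \<gamma> w else \<beta> w)" for w
  have "satisfies \<beta>' q" if q: "q \<in> Q" and all: "\<forall>i\<in>I. leaf q i \<in> U \<union> P" for q
  proof (cases "\<forall>i\<in>I. leaf q i \<in> U")
    case True
    then have "\<forall>i\<in>I. \<beta>' (leaf q i) = \<beta> (leaf q i)" using P_sub by (auto simp: \<beta>'_def)
    then show ?thesis using \<beta>(2)[OF q True] unfolding satisfies_def by metis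
  next
    case False
    then have inP: "leaf q i \<in> P" if "i \<in> I" for i using all Ucl(1)[OF q] that by auto
    show ?thesis
      unfolding satisfies_def
    proof (intro ballI)
      fix i i' assume i: "i \<in> I" "i' \<in> I"
      show "proj q i (\<beta>' (leaf q i)) = proj q i' (\<beta>' (leaf q i'))"
        unfolding \<beta>'_def using inP i \<gamma>
        by (auto intro: deficit_eq_0_proj[OF q nn zero[OF q] i])
    qed
  qed
  moreover have "\<forall>w. \<beta>' w \<in> B" using \<beta> \<gamma> by (auto simp: \<beta>'_def)
  moreover have "closed_set (U \<union> P)"
    using Ucl Pcl P_sub unfolding closed_set_def by blast
  ultimately show ?thesis unfolding good_set_def P_def by blast
qed

text \<open>A largest good set \<open>U\<close> makes the deficit strictly positive on non-zero weightings supported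
  outside \<open>U\<close>: otherwise their support would enlarge \<open>U\<close>. Restricting to a complement is needed because
  some components of the game may be satisfiable.\<close>

lemma collision_gap:
  assumes unsat: "\<nexists>\<beta>. (\<forall>w. \<beta> w \<in> B) \<and> (\<forall>q\<in>Q. satisfies \<beta> q)"
  obtains r where "\<And>w. 0 \<le> r w" "sum r W < 1"
    "\<And>F. (\<And>w b. 0 \<le> F w b) \<Longrightarrow> collision F \<le> (\<Sum>w\<in>W. r w * (mass F w)\<^sup>2)"
proof -
  have "good_set {}"
    unfolding good_set_def closed_set_def using I_nonempty B_nonempty by auto
  then obtain U where U: "good_set U" and Umax: "\<And>V. good_set V \<Longrightarrow> card V \<le> card U"
    using ex_has_greatest_nat[of good_set "{}" card "Suc (card W)"] finite_W
    by (auto simp: good_set_def closed_set_def card_mono less_Suc_eq_le)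
  have U_sub: "U \<subseteq> W" and Ucl: "\<And>q. q \<in> Q \<Longrightarrow> (\<forall>i\<in>I. leaf q i \<in> U) \<or> (\<forall>i\<in>I. leaf q i \<notin> U)"
    using U by (auto simp: good_set_def closed_set_def)
  have "U \<noteq> W" using U unsat leaf_in_W unfolding good_set_def by blast
  define C where "C = W - U"
  have C: "C \<noteq> {}" "C \<subseteq> W" "finite C"
    using \<open>U \<noteq> W\<close> U_sub finite_W by (auto simp: C_def)
  define gap where "gap F = avg Q \<mu> (deficit (\<lambda>w b. F (w, b)))" for F :: "'w \<times> 'b \<Rightarrow> real"
  \<comment> \<open>Normalised weightings supported on \<open>C\<close>. The averaged deficit is
    continuous and positive on this compact set, hence bounded away from 0.\<close>
  define K where "K = {F. (\<forall>z\<in>C \<times> B. F z \<in> {0..1}) \<and> (\<forall>z. z \<notin> C \<times> B \<longrightarrow> F z = (0::real))} \<inter>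
    (\<lambda>F. \<Sum>z\<in>C \<times> B. F z) -` {1}"
  have cont_coord: "continuous_on A (\<lambda>F. F z)" for A and z :: "'w \<times> 'b" 
    by (rule continuous_on_subset[OF continuous_on_product_coordinates]) auto
  have "compact K"
    unfolding K_def
    by (intro compact_Int_closed compact_box_functions closed_vimage closed_singleton
      continuous_intros cont_coord)
  have K_nonneg: "0 \<le> F z" if "F \<in> K" for F z
    using that unfolding K_def
    by (cases "z \<in> C \<times> B") (auto simp del: split_paired_All mem_Sigma_iff)
  have K_nonempty: "K \<noteq> {}"
  proof -
    obtain z where z: "z \<in> C \<times> B" using C B_nonempty by auto
    then have "(\<lambda>x. if x = z then 1 else 0) \<in> K" using C finite_B by (auto simp: K_def)
    then show ?thesis by auto
  qed
  have "continuous_on K gap"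
    unfolding gap_def deficit_def mass_def vote_def avg_def
    by (intro continuous_intros cont_coord)
  then obtain F0 where F0: "F0 \<in> K" and F0_min: "\<And>F. F \<in> K \<Longrightarrow> gap F0 \<le> gap F"
    using continuous_attains_inf[OF \<open>compact K\<close> K_nonempty] by blast
  \<comment> \<open>The cap at 1 keeps the factor \<open>1 - \<delta>\<close> in \<open>r\<close>
    non-negative.\<close>
  define \<delta> where "\<delta> = min 1 (gap F0)"
  have gap_pos: "0 < gap F" if F: "F \<in> K" for F
  proof (rule ccontr)
    define f where "f = (\<lambda>w b. F (w, b))"
    have nn: "0 \<le> f w b" for w b using K_nonneg[OF F] by (simp add: f_def)
    assume "\<not> 0 < gap F"
    moreover have "0 \<le> gap F"
      unfolding gap_def by (intro avg_nonneg dist_Q deficit_nonneg K_nonneg[OF F])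
    ultimately have "avg Q \<mu> (deficit f) = 0" by (simp add: gap_def f_def)
    then have "\<forall>q\<in>Q. \<mu> q * deficit f q = 0"
      using finite_Q pos_Q deficit_nonneg[of _ f, OF _ nn] unfolding avg_def
      by (subst (asm) sum_nonneg_eq_0_iff) (auto simp: less_imp_le)
    then have zero: "deficit f q = 0" if "q \<in> Q" for q
      using that pos_Q by fastforce
    have supp: "f w b = 0" if "w \<notin> W - U" for w b
      using F that by (auto simp: K_def f_def C_def)
    have "good_set (U \<union> {w. 0 < mass f w})" (is "good_set (U \<union> ?P)")
      by (rule deficit_zero_good_extension[OF U nn zero supp])
    moreover from this have "finite (U \<union> ?P)"
      using finite_W by (auto simp: good_set_def closed_set_def intro: finite_subset)
    moreover have "\<exists>w\<in>?P. w \<notin> U"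
    proof -
      have "(\<Sum>w\<in>C. mass f w) = 1"
        using F by (simp add: K_def mass_def f_def sum.cartesian_product)
      then obtain w where "w \<in> C" "mass f w \<noteq> 0" by (metis sum.neutral zero_neq_one)
      moreover have "0 \<le> mass f w" unfolding mass_def by (intro sum_nonneg nn)
      ultimately show ?thesis by (intro bexI[of _ w]) (auto simp: C_def)
    qed
    ultimately have "card U < card (U \<union> ?P)" by (intro psubset_card_mono) auto
    then show False using Umax[OF \<open>good_set (U \<union> ?P)\<close>] by simp
  qed
  have \<delta>: "0 < \<delta>" "\<delta> \<le> 1" using gap_pos[OF F0] by (auto simp: \<delta>_def)
  have main: "\<delta> * (\<Sum>w\<in>C. mass F w)\<^sup>2 \<le> avg Q \<mu> (deficit F)" if nn: "\<And>w b. 0 \<le> F w b" for F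
  proof -
    define s where "s = (\<Sum>w\<in>C. mass F w)"
    have s0: "0 \<le> s" unfolding s_def mass_def by (intro sum_nonneg nn)
    show ?thesis
    proof (cases "s = 0")
      case True
      then show ?thesis using avg_nonneg[OF dist_Q, of "deficit F"] deficit_nonneg[of _ F, OF _ nn]
        by (simp add: s_def)
    next
      case False
      then have s: "0 < s" using s0 by simp
      \<comment> \<open>The restriction of \<open>F\<close> to \<open>C\<close>, scaled to total
        mass 1. The leaves of each \<open>q\<close> lie all in \<open>U\<close>, where
        \<open>E\<close> vanishes, or all in \<open>C\<close>, where the deficits differ by the
        factor \<open>s\<^sup>2\<close>.\<close>
      define E where "E z = (if z \<in> C \<times> B then F (fst z) (snd z) / s else 0)" for z
      have s_eq: "s = (\<Sum>z\<in>C \<times> B. F (fst z) (snd z))"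
        by (simp add: s_def mass_def sum.cartesian_product case_prod_unfold)
      have "E \<in> K"
        unfolding K_def
      proof (intro IntI CollectI conjI ballI allI impI vimageI2)
        fix z assume z: "z \<in> C \<times> B"
        have "F (fst z) (snd z) \<le> s"
          unfolding s_eq using z C finite_B nn
          by (intro member_le_sum[of _ _ "\<lambda>z. F (fst z) (snd z)"]) auto
        then show "E z \<in> {0..1}" using z s nn by (auto simp: E_def)
      next
        have "(\<Sum>z\<in>C \<times> B. E z) = (\<Sum>z\<in>C \<times> B. F (fst z) (snd z) / s)"
          by (intro sum.cong) (auto simp: E_def)
        then show "(\<Sum>z\<in>C \<times> B. E z) \<in> {1}"
          using s by (simp add: s_eq flip: sum_divide_distrib)
      qed (auto simp: E_def)
      then have "\<delta> \<le> gap E" using F0_min by (fastforce simp: \<delta>_def)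
      have "s\<^sup>2 * deficit (\<lambda>w b. E (w, b)) q \<le> deficit F q" if q: "q \<in> Q" for q
      proof (cases "\<forall>i\<in>I. leaf q i \<in> U")
        case True
        then have z: "E (leaf q i, b) = 0" if "i \<in> I" for i b using that by (auto simp: E_def C_def)
        have "deficit (\<lambda>w b. E (w, b)) q = 0"
          unfolding deficit_def mass_def vote_def avg_def by (simp add: z)
        then show ?thesis using deficit_nonneg[OF q, of F, OF nn] by simp
      next
        case False
        then have "leaf q i \<in> C" if "i \<in> I" for i
          using Ucl[OF q] that leaf_in_W[OF q] by (auto simp: C_def)
        then have e: "F (leaf q i) b = s * E (leaf q i, b)" if "i \<in> I" "b \<in> B" for i b
          using that s by (simp add: E_def)
        have m: "mass F (leaf q i) = s * mass (\<lambda>w b. E (w, b)) (leaf q i)" if "i \<in> I" for i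
          unfolding mass_def sum_distrib_left using e that by (intro sum.cong) auto
        have "vote F q c = s * vote (\<lambda>w b. E (w, b)) q c" for c
          unfolding vote_def avg_cmult[symmetric] sum_distrib_left using e
          by (intro avg_cong sum.cong) auto
        moreover have "avg I \<nu> (\<lambda>i. (mass F (leaf q i))\<^sup>2)
            = s\<^sup>2 * avg I \<nu> (\<lambda>i. (mass (\<lambda>w b. E (w, b)) (leaf q i))\<^sup>2)"
          unfolding avg_cmult[symmetric] using m by (intro avg_cong) (simp add: power_mult_distrib)
        ultimately have "deficit F q = s\<^sup>2 * deficit (\<lambda>w b. E (w, b)) q"
          unfolding deficit_def by (simp add: power_mult_distrib sum_distrib_left right_diff_distrib)
        then show ?thesis by simp
      qed
      then have "s\<^sup>2 * gap E \<le> avg Q \<mu> (deficit F)"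
        unfolding gap_def avg_cmult[symmetric] by (intro avg_mono[OF dist_Q])
      moreover have "\<delta> * s\<^sup>2 \<le> s\<^sup>2 * gap E"
        using mult_right_mono[OF \<open>\<delta> \<le> gap E\<close>, of "s\<^sup>2"] by (simp add: mult.commute)
      ultimately show ?thesis by (simp add: s_def)
    qed
  qed
  \<comment> \<open>The gain is spread over \<open>C\<close> in proportion to the leaf weights, so
    the total drops by \<open>\<delta>\<close> times the weight of \<open>C\<close>.\<close>
  define r where "r w = leaf_weight w * (if w \<in> C then 1 - \<delta> else 1)" for w
  show ?thesis
  proof
    show "0 \<le> r w" for w using leaf_weight_nonneg[of w] \<delta> by (simp add: r_def)
    have "sum r W < sum leaf_weight W"
    proof (rule sum_strict_mono_ex1[OF finite_W])
      show "\<forall>w\<in>W. r w \<le> leaf_weight w"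
        using leaf_weight_nonneg \<delta> by (auto simp: r_def algebra_simps)
      obtain w where "w \<in> C" using C by auto
      then show "\<exists>w\<in>W. r w < leaf_weight w"
        using leaf_weight_pos[of w] \<delta> C by (intro bexI[of _ w]) (auto simp: r_def algebra_simps)
    qed
    then show "sum r W < 1" by (simp add: sum_leaf_weight)
    fix F :: "'w \<Rightarrow> 'b \<Rightarrow> real" assume nn: "\<And>w b. 0 \<le> F w b"
    have mn: "0 \<le> mass F w" for w unfolding mass_def by (intro sum_nonneg nn)
    have w1: "leaf_weight w \<le> 1" if "w \<in> W" for w
      unfolding sum_leaf_weight[symmetric] using that finite_W leaf_weight_nonneg
      by (intro member_le_sum) auto
    have "(\<Sum>w\<in>C. leaf_weight w * (mass F w)\<^sup>2) \<le> (\<Sum>w\<in>C. (mass F w)\<^sup>2)"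
      using w1 C leaf_weight_nonneg by (intro sum_mono) (auto intro!: mult_left_le_one_le)
    also have "\<dots> \<le> (\<Sum>w\<in>C. mass F w)\<^sup>2" using mn C by (intro sum_power2_le) auto
    finally have "\<delta> * (\<Sum>w\<in>C. leaf_weight w * (mass F w)\<^sup>2) \<le> \<delta> * (\<Sum>w\<in>C. mass F w)\<^sup>2"
      using \<delta> by (intro mult_left_mono) auto
    also have "\<dots> \<le> avg Q \<mu> (deficit F)" by (rule main[OF nn])
    finally have "\<delta> * (\<Sum>w\<in>C. leaf_weight w * (mass F w)\<^sup>2) \<le> avg Q \<mu> (deficit F)" .
    moreover have "(\<Sum>w\<in>W. r w * (mass F w)\<^sup>2)
      = (\<Sum>w\<in>W. leaf_weight w * (mass F w)\<^sup>2) - \<delta> * (\<Sum>w\<in>C. leaf_weight w * (mass F w)\<^sup>2)"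
    proof -
      have "\<delta> * (\<Sum>w\<in>C. leaf_weight w * (mass F w)\<^sup>2)
        = (\<Sum>w\<in>W. if w \<in> C then \<delta> * (leaf_weight w * (mass F w)\<^sup>2) else 0)"
        using C finite_W by (simp add: sum_distrib_left sum.If_cases Int_absorb1)
      then show ?thesis
        by (simp only: sum_subtractf[symmetric]) (auto intro!: sum.cong simp: r_def left_diff_distrib right_diff_distrib)
    qed
    ultimately show "collision F \<le> (\<Sum>w\<in>W. r w * (mass F w)\<^sup>2)"
      unfolding avg_deficit by simp
  qed
qed

subsection \<open>Repetition\<close>

definition leaves :: "'q list \<Rightarrow> 'i list \<Rightarrow> 'w list" where
  "leaves qs is = map2 leaf qs is"

definition projs :: "'q list \<Rightarrow> 'i list \<Rightarrow> 'b list \<Rightarrow> 'd list" where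
  "projs qs is bs = map (\<lambda>(q, i, b). proj q i b) (zip qs (zip is bs))"

definition votes :: "nat \<Rightarrow> ('w list \<Rightarrow> 'b list) \<Rightarrow> 'q list \<Rightarrow> 'd list \<Rightarrow> real" where
  "votes n g qs ds = Avg I (replicate n \<nu>) (\<lambda>is. of_bool (projs qs is (g (leaves qs is)) = ds))"

definition collisions :: "nat \<Rightarrow> ('w list \<Rightarrow> 'b list) \<Rightarrow> real" where
  "collisions n g = Avg Q (replicate n \<mu>) (\<lambda>qs. \<Sum>ds\<in>words D n. (votes n g qs ds)\<^sup>2)"

lemma leaves_simps [simp]:
  "leaves [] [] = []" "leaves (q # qs) (i # is) = leaf q i # leaves qs is"
  by (simp_all add: leaves_def)

lemma projs_simps [simp]:
  "projs [] [] [] = []" "projs (q # qs) (i # is) (b # bs) = proj q i b # projs qs is bs"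
  by (simp_all add: projs_def)

lemma length_leaves [simp]: "length (leaves qs is) = min (length qs) (length is)"
  by (simp add: leaves_def)

lemma dist_Qs: "is_dist (words Q n) (weight (replicate n \<mu>))"
  using is_dist_words[of Q "replicate n \<mu>"] finite_Q dist_Q by auto

lemma dist_Is: "is_dist (words I n) (weight (replicate n \<nu>))"
  using is_dist_words[of I "replicate n \<nu>"] finite_I dist_I by auto

text \<open>With the other questions and labels frozen, a repeated strategy is a fractional strategy
  in the first coordinate. The one-coordinate bound is diagonal in the masses, so what remains is a
  weighted sum of collision probabilities for \<open>n\<close> coordinates.\<close>

lemma collisions_Suc:
  assumes step: "\<And>F. (\<And>w b. 0 \<le> F w b) \<Longrightarrow> collision F \<le> (\<Sum>w\<in>W. r w * (mass F w)\<^sup>2)"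
    and g: "\<And>ws. length ws = Suc n \<Longrightarrow> g ws \<in> words B (Suc n)"
  shows "collisions (Suc n) g \<le> (\<Sum>w\<in>W. r w * collisions n (\<lambda>ws. tl (g (w # ws))))"
proof -
  let ?Qs = "avg (words Q n) (weight (replicate n \<mu>))"
  let ?Is = "avg (words I n) (weight (replicate n \<nu>))"
  define g' where "g' w ws = tl (g (w # ws))" for w ws
  \<comment> \<open>Its votes are those of \<open>g\<close> on the label list \<open>c # ds\<close>;
    its masses are the votes of the tail strategy \<open>g' w\<close>, in which the first question
    is hard-wired.\<close>
  define F where "F qs ds w b = ?Is (\<lambda>is. of_bool (hd (g (w # leaves qs is)) = b \<and>
      projs qs is (g' w (leaves qs is)) = ds))" for qs ds w b
  have F_nonneg: "0 \<le> F qs ds w b" for qs ds w b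
    unfolding F_def by (intro avg_nonneg[OF dist_Is]) simp
  have g_eq: "g (w # ws) = hd (g (w # ws)) # g' w ws" "hd (g (w # ws)) \<in> B" if "length ws = n" for w ws
    using g[of "w # ws"] that by (cases "g (w # ws)"; auto simp: g'_def words_def)+
  have votes_eq: "votes (Suc n) g (q # qs) (c # ds) = vote (F qs ds) q c"
    if "qs \<in> words Q n" for q qs c ds
  proof -
    have "votes (Suc n) g (q # qs) (c # ds) = avg I \<nu> (\<lambda>i. ?Is (\<lambda>is.
        of_bool (projs (q # qs) (i # is) (g (leaf q i # leaves qs is)) = c # ds)))"
      by (simp add: votes_def) (simp add: Avg_def)
    also have "\<dots> = avg I \<nu> (\<lambda>i. ?Is (\<lambda>is. \<Sum>b\<in>{b \<in> B. proj q i b = c}.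
        of_bool (hd (g (leaf q i # leaves qs is)) = b \<and> projs qs is (g' (leaf q i) (leaves qs is)) = ds)))"
    proof (intro avg_cong)
      fix i "is" assume "is \<in> words I n"
      then have len: "length (leaves qs is) = n" using that by (simp add: length_words)
      let ?b = "hd (g (leaf q i # leaves qs is))" and ?P = "projs qs is (g' (leaf q i) (leaves qs is)) = ds"
      have "(\<Sum>b\<in>{b \<in> B. proj q i b = c}. of_bool (?b = b \<and> ?P))
          = (\<Sum>b\<in>{b \<in> B. proj q i b = c}. if ?b = b then of_bool ?P else (0::real))"
        by (intro sum.cong) auto
      also have "\<dots> = of_bool (proj q i ?b = c \<and> ?P)"
        using finite_B g_eq(2)[OF len] by (subst sum.delta') auto
      finally show "of_bool (projs (q # qs) (i # is) (g (leaf q i # leaves qs is)) = c # ds)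
          = (\<Sum>b\<in>{b \<in> B. proj q i b = c}. of_bool (?b = b \<and> ?P) :: real)"
        by (subst g_eq(1)[OF len]) simp
    qed
    also have "\<dots> = vote (F qs ds) q c"
      unfolding vote_def F_def by (simp add: avg_sum)
    finally show ?thesis .
  qed
  have mass_eq: "mass (F qs ds) w = votes n (g' w) qs ds" if "qs \<in> words Q n" for qs ds w
  proof -
    have "mass (F qs ds) w = ?Is (\<lambda>is. \<Sum>b\<in>B. of_bool (hd (g (w # leaves qs is)) = b \<and>
      projs qs is (g' w (leaves qs is)) = ds))"
      unfolding mass_def F_def by (simp add: avg_sum)
    also have "\<dots> = ?Is (\<lambda>is. of_bool (projs qs is (g' w (leaves qs is)) = ds))"
    proof (intro avg_cong)
      fix "is" assume "is \<in> words I n"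
      then have len: "length (leaves qs is) = n" using that by (simp add: length_words)
      let ?b = "hd (g (w # leaves qs is))" and ?P = "projs qs is (g' w (leaves qs is)) = ds"
      have "(\<Sum>b\<in>B. of_bool (?b = b \<and> ?P)) = (\<Sum>b\<in>B. if ?b = b then of_bool ?P else (0::real))"
        by (intro sum.cong) auto
      also have "\<dots> = of_bool ?P"
        using finite_B g_eq(2)[OF len] by (subst sum.delta') auto
      finally show "(\<Sum>b\<in>B. of_bool (?b = b \<and> ?P) :: real) = of_bool ?P" .
    qed
    finally show ?thesis by (simp add: votes_def Avg_def)
  qed
  have "collisions (Suc n) g = avg Q \<mu> (\<lambda>q. ?Qs (\<lambda>qs. \<Sum>c\<in>D. \<Sum>ds\<in>words D n.
      (votes (Suc n) g (q # qs) (c # ds))\<^sup>2))"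
    by (simp add: collisions_def sum_words_Suc) (simp add: Avg_def)
  also have "\<dots> = avg Q \<mu> (\<lambda>q. ?Qs (\<lambda>qs. \<Sum>ds\<in>words D n. \<Sum>c\<in>D. (vote (F qs ds) q c)\<^sup>2))"
    by (intro avg_cong, subst sum.swap) (simp add: votes_eq)
  also have "\<dots> = ?Qs (\<lambda>qs. \<Sum>ds\<in>words D n. collision (F qs ds))"
    by (subst avg_swap) (simp add: collision_def avg_sum)
  also have "\<dots> \<le> ?Qs (\<lambda>qs. \<Sum>ds\<in>words D n. \<Sum>w\<in>W. r w * (mass (F qs ds) w)\<^sup>2)"
    by (intro avg_mono[OF dist_Qs] sum_mono step F_nonneg)
  also have "\<dots> = ?Qs (\<lambda>qs. \<Sum>w\<in>W. r w * (\<Sum>ds\<in>words D n. (votes n (g' w) qs ds)\<^sup>2))"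
    by (intro avg_cong, subst sum.swap) (simp add: mass_eq sum_distrib_left)
  also have "\<dots> = (\<Sum>w\<in>W. r w * collisions n (g' w))"
    by (simp add: collisions_def Avg_def avg_sum avg_cmult)
  finally show ?thesis by (simp add: g'_def[abs_def])
qed

lemma collisions_exponential_decay:
  assumes r: "\<And>w. 0 \<le> r w"
    and step: "\<And>F. (\<And>w b. 0 \<le> F w b) \<Longrightarrow> collision F \<le> (\<Sum>w\<in>W. r w * (mass F w)\<^sup>2)"
    and g: "\<And>ws. length ws = n \<Longrightarrow> g ws \<in> words B n"
  shows "collisions n g \<le> (sum r W) ^ n"
  using g
proof (induction n arbitrary: g)
  case 0
  then have "g [] = []" by simp
  then show ?case by (simp add: collisions_def votes_def)
next
  case (Suc n)
  have "collisions (Suc n) g \<le> (\<Sum>w\<in>W. r w * collisions n (\<lambda>ws. tl (g (w # ws))))"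
    by (rule collisions_Suc[OF step Suc.prems])
  also have "\<dots> \<le> (\<Sum>w\<in>W. r w * (sum r W) ^ n)"
  proof (intro sum_mono mult_left_mono r Suc.IH)
    fix w :: 'w and ws :: "'w list" assume "length ws = n"
    then have "g (w # ws) \<in> words B (Suc n)" using Suc.prems by simp
    then show "tl (g (w # ws)) \<in> words B n" by (cases "g (w # ws)") (auto simp: words_def)
  qed
  also have "\<dots> = (sum r W) ^ Suc n" by (simp add: sum_distrib_right)
  finally show ?case .
qed

text \<open>Cauchy-Schwarz over \<open>qs\<close>; then the squared vote for the first player's
  label list \<open>d qs\<close> is one of the summands of the collision probability.\<close>

lemma agreement_le_collisions:
  assumes "\<And>qs. qs \<in> words Q n \<Longrightarrow> d qs \<in> words D n"
  shows "(Avg Q (replicate n \<mu>) (\<lambda>qs. votes n g qs (d qs)))\<^sup>2 \<le> collisions n g"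
proof -
  have "(Avg Q (replicate n \<mu>) (\<lambda>qs. votes n g qs (d qs)))\<^sup>2
      \<le> Avg Q (replicate n \<mu>) (\<lambda>qs. (votes n g qs (d qs))\<^sup>2)"
    using avg_power2[OF dist_Qs] by (simp add: Avg_def)
  also have "\<dots> \<le> collisions n g"
    unfolding collisions_def Avg_def length_replicate
    by (intro avg_mono[OF dist_Qs] member_le_sum[of _ _ "\<lambda>ds. (votes n g _ ds)\<^sup>2"])
      (use assms finite_D in auto)
  finally show ?thesis .
qed

theorem agreement_exponential_decay:
  assumes "\<nexists>\<beta>. (\<forall>w. \<beta> w \<in> B) \<and> (\<forall>q\<in>Q. satisfies \<beta> q)"
  shows "\<exists>s. 0 \<le> s \<and> s < 1 \<and> (\<forall>n g d. (\<forall>ws. length ws = n \<longrightarrow> g ws \<in> words B n) \<longrightarrow>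
      (\<forall>qs\<in>words Q n. d qs \<in> words D n) \<longrightarrow>
      (Avg Q (replicate n \<mu>) (\<lambda>qs. votes n g qs (d qs)))\<^sup>2 \<le> s ^ n)"
proof -
  obtain r where r: "\<And>w. 0 \<le> r w" "sum r W < 1"
    "\<And>F. (\<And>w b. 0 \<le> F w b) \<Longrightarrow> collision F \<le> (\<Sum>w\<in>W. r w * (mass F w)\<^sup>2)"
    using collision_gap[OF assms] by metis
  show ?thesis
  proof (intro exI conjI allI impI)
    show "0 \<le> sum r W" by (intro sum_nonneg r)
    show "sum r W < 1" by (rule r)
    fix n :: nat and g :: "'w list \<Rightarrow> 'b list" and d
    assume g: "\<forall>ws. length ws = n \<longrightarrow> g ws \<in> words B n" and d: "\<forall>qs\<in>words Q n. d qs \<in> words D n"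
    have "(Avg Q (replicate n \<mu>) (\<lambda>qs. votes n g qs (d qs)))\<^sup>2 \<le> collisions n g"
      using d by (intro agreement_le_collisions) blast
    also have "\<dots> \<le> (sum r W) ^ n"
      using g by (intro collisions_exponential_decay r) blast+
    finally show "(Avg Q (replicate n \<mu>) (\<lambda>qs. votes n g qs (d qs)))\<^sup>2 \<le> (sum r W) ^ n" .
  qed
qed

section \<open>From k players to two\<close>

definition leaf_prob :: "'i \<Rightarrow> 'w \<Rightarrow> real" where
  "leaf_prob i w = avg Q \<mu> (\<lambda>q. of_bool (leaf q i = w))"

text \<open>The conditional law of \<open>q\<close> given \<open>leaf q i = w\<close>. On null
  events \<open>\<mu>\<close> serves as default, so that the result is always a
  distribution.\<close>

definition cond_prob :: "'i \<Rightarrow> 'w \<Rightarrow> 'q \<Rightarrow> real" where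
  "cond_prob i w q = (if leaf_prob i w = 0 then \<mu> q else \<mu> q * of_bool (leaf q i = w) / leaf_prob i w)"

lemma dist_leaf_prob:
  assumes "i \<in> I"
  shows "is_dist W (leaf_prob i)"
  unfolding is_dist_def
proof (intro conjI finite_W ballI)
  show "0 \<le> leaf_prob i w" for w unfolding leaf_prob_def by (intro avg_nonneg dist_Q) auto
  have "sum (leaf_prob i) W = avg Q \<mu> (\<lambda>q. \<Sum>w\<in>W. of_bool (leaf q i = w) * 1)"
    unfolding leaf_prob_def by (simp add: avg_sum)
  also have "\<dots> = avg Q \<mu> (\<lambda>q. 1)"
    by (intro avg_cong sum_leaf_indicator assms)
  finally show "sum (leaf_prob i) W = 1" by (simp add: avg_const dist_Q)
qed

lemma dist_cond_prob: "is_dist Q (cond_prob i w)"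
proof -
  have "0 \<le> leaf_prob i w" unfolding leaf_prob_def by (intro avg_nonneg dist_Q) auto
  moreover have "sum (cond_prob i w) Q = 1"
  proof (cases "leaf_prob i w = 0")
    case True
    then show ?thesis using dist_Q by (simp add: cond_prob_def is_dist_def)
  next
    case False
    then have "sum (cond_prob i w) Q = (\<Sum>q\<in>Q. \<mu> q * of_bool (leaf q i = w)) / leaf_prob i w"
      unfolding cond_prob_def sum_divide_distrib by simp
    then show ?thesis using False by (simp add: leaf_prob_def avg_def)
  qed
  ultimately show ?thesis
    using pos_Q finite_Q by (auto simp: is_dist_def cond_prob_def less_imp_le)
qed

lemma disintegration:
  assumes i: "i \<in> I"
  shows "avg W (leaf_prob i) (\<lambda>w. avg Q (cond_prob i w) (f w)) = avg Q \<mu> (\<lambda>q. f (leaf q i) q)"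
proof -
  \<comment> \<open>If \<open>w\<close> has probability 0, both sides vanish, so the default is
    harmless.\<close>
  have *: "leaf_prob i w * cond_prob i w q = \<mu> q * of_bool (leaf q i = w)" if "q \<in> Q" for w q
  proof (cases "leaf_prob i w = 0")
    case True
    then have "\<forall>q\<in>Q. \<mu> q * of_bool (leaf q i = w) = 0"
      unfolding leaf_prob_def avg_def using finite_Q pos_Q
      by (subst (asm) sum_nonneg_eq_0_iff) (auto simp: less_imp_le)
    then show ?thesis using True that by simp
  qed (simp add: cond_prob_def)
  have "avg W (leaf_prob i) (\<lambda>w. avg Q (cond_prob i w) (f w))
      = (\<Sum>w\<in>W. \<Sum>q\<in>Q. \<mu> q * (of_bool (leaf q i = w) * f w q))"
    unfolding avg_def sum_distrib_left
    by (intro sum.cong refl) (simp add: mult.assoc[symmetric] *)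
  also have "\<dots> = avg Q \<mu> (\<lambda>q. \<Sum>w\<in>W. of_bool (leaf q i = w) * f w q)"
    unfolding avg_def sum_distrib_left by (rule sum.swap)
  also have "\<dots> = avg Q \<mu> (\<lambda>q. f (leaf q i) q)"
    by (intro avg_cong sum_leaf_indicator i)
  finally show ?thesis .
qed

text \<open>The coordinates are independent, so \<open>disintegration\<close> applies to each one
  with its own index; interchanging averages moves all leaves to the outside.\<close>

lemma Avg_disintegration:
  assumes "set is \<subseteq> I"
  shows "Avg W (map leaf_prob is) (\<lambda>ws. Avg Q (map2 cond_prob is ws) (f ws))
    = Avg Q (replicate (length is) \<mu>) (\<lambda>qs. f (leaves qs is) qs)"
  using assms
proof (induction "is" arbitrary: f)
  case (Cons i "is")
  have "Avg W (map leaf_prob (i # is)) (\<lambda>ws. Avg Q (map2 cond_prob (i # is) ws) (f ws))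
      = avg W (leaf_prob i) (\<lambda>w. avg Q (cond_prob i w) (\<lambda>q.
          Avg W (map leaf_prob is) (\<lambda>ws. Avg Q (map2 cond_prob is ws) (\<lambda>qs. f (w # ws) (q # qs)))))"
    by simp (auto simp: Avg_def intro!: avg_cong avg_swap)
  also have "\<dots> = avg W (leaf_prob i) (\<lambda>w. avg Q (cond_prob i w) (\<lambda>q.
      Avg Q (replicate (length is) \<mu>) (\<lambda>qs. f (w # leaves qs is) (q # qs))))"
    using Cons by simp
  also have "\<dots> = avg Q \<mu> (\<lambda>q. Avg Q (replicate (length is) \<mu>)
      (\<lambda>qs. f (leaf q i # leaves qs is) (q # qs)))"
    using Cons.prems by (intro disintegration) auto
  finally show ?case by simp
qed simp

text \<open>Given the leaves \<open>ws\<close> seen by the second player, the two question lists \<open>qs\<close> and \<open>qs'\<close> are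
  independent; the second player answers as if the questions were a fixed good choice of \<open>qs'\<close>.\<close>

lemma resampling_strategy:
  assumes idx: "\<And>q i. q \<in> Q \<Longrightarrow> i \<in> I \<Longrightarrow> idx (leaf q i) = i"
    and consistent: "\<And>is qs qs'. is \<in> words I n \<Longrightarrow> qs \<in> words Q n \<Longrightarrow> qs' \<in> words Q n \<Longrightarrow>
      leaves qs is = leaves qs' is \<Longrightarrow> (\<And>R. R \<subseteq> I \<Longrightarrow> acc (mix R is qs qs')) \<Longrightarrow>
      projs qs is (b is qs') = d qs"
    and b: "\<And>is qs. is \<in> words I n \<Longrightarrow> qs \<in> words Q n \<Longrightarrow> b is qs \<in> words B n"
  obtains g where "\<And>ws. length ws = n \<Longrightarrow> g ws \<in> words B n"
    "(Avg Q (replicate n \<mu>) (\<lambda>qs. of_bool (acc qs))) ^ (2 ^ card I)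
      \<le> Avg Q (replicate n \<mu>) (\<lambda>qs. votes n g qs (d qs))"
proof -
  define \<psi> where "\<psi> is qs qs' = (of_bool (projs qs is (b is qs') = d qs) :: real)" for "is" qs qs'
  have dist_cond: "is_dist (words Q n) (weight (map2 cond_prob is ws))"
    if "length is = n" "length ws = n" for "is" ws
    using is_dist_words[of Q "map2 cond_prob is ws"] finite_Q dist_cond_prob that
    by (auto split: prod.splits)
  \<comment> \<open>Some fixed list does at least as well as a random \<open>qs'\<close>.\<close>
  have "\<exists>y\<in>words Q n. Avg Q (map2 cond_prob is ws) (\<lambda>qs'. Avg Q (map2 cond_prob is ws) (\<lambda>qs. \<psi> is qs qs'))
      \<le> Avg Q (map2 cond_prob is ws) (\<lambda>qs. \<psi> is qs y)" if "length is = n" "length ws = n" for "is" ws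
    using avg_le_some[OF dist_cond[OF that],
        of "\<lambda>qs'. Avg Q (map2 cond_prob is ws) (\<lambda>qs. \<psi> is qs qs')"] that
    unfolding Avg_def[of Q "map2 cond_prob is ws"] by auto
  then obtain y where y: "y is ws \<in> words Q n"
    "Avg Q (map2 cond_prob is ws) (\<lambda>qs'. Avg Q (map2 cond_prob is ws) (\<lambda>qs. \<psi> is qs qs'))
      \<le> Avg Q (map2 cond_prob is ws) (\<lambda>qs. \<psi> is qs (y is ws))"
    if "length is = n" "length ws = n" for "is" ws by metis
  obtain b0 where b0: "b0 \<in> B" using B_nonempty by auto
  \<comment> \<open>Leaves reveal their indices, so the second player can recover \<open>is\<close>;
    a dummy answer covers ill-formed lists.\<close>
  define g where "g ws = (let is = map idx ws in
    if is \<in> words I n then b is (y is ws) else replicate n b0)" for ws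
  have g: "g ws \<in> words B n" if "length ws = n" for ws
    using that b b0 y(1) by (auto simp: g_def Let_def words_def[of B])
  have g_leaves: "g (leaves qs is) = b is (y is (leaves qs is))"
    if "qs \<in> words Q n" "is \<in> words I n" for qs "is"
  proof -
    have "map idx (leaves qs is) = is"
      using that by (intro nth_equalityI) (auto simp: leaves_def length_words nth_words idx)
    then show ?thesis using that by (simp add: g_def)
  qed
  let ?v = "Avg Q (replicate n \<mu>) (\<lambda>qs. of_bool (acc qs))"
  \<comment> \<open>Jensen moves the power inside the average over \<open>ws\<close>; given
    \<open>ws\<close>, the box inequality applies to two conditionally independent question
    lists.\<close>
  have main: "?v ^ (2 ^ card I)
      \<le> Avg Q (replicate n \<mu>) (\<lambda>qs. of_bool (projs qs is (g (leaves qs is)) = d qs))"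
    if "is": "is \<in> words I n" for "is"
  proof -
    have len: "length is = n" and sub: "set is \<subseteq> I" using "is" by (auto simp: words_def)
    let ?E = "\<lambda>ws. Avg Q (map2 cond_prob is ws)"
    have dist_W: "is_dist (words W n) (weight (map leaf_prob is))"
      using is_dist_words[of W "map leaf_prob is"] finite_W dist_leaf_prob sub len by auto
    have "?v = Avg W (map leaf_prob is) (\<lambda>ws. ?E ws (\<lambda>qs. of_bool (acc qs)))"
      using Avg_disintegration[OF sub, of "\<lambda>ws qs. of_bool (acc qs)"] len by simp
    also have "\<dots> ^ (2 ^ card I) \<le> Avg W (map leaf_prob is) (\<lambda>ws. (?E ws (\<lambda>qs. of_bool (acc qs))) ^ (2 ^ card I))"
      unfolding Avg_def[of W] length_map len
      by (intro avg_power_two_power[OF dist_W])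
        (auto simp: Avg_def length_words len intro!: avg_nonneg dist_cond)
    also have "\<dots> \<le> Avg W (map leaf_prob is) (\<lambda>ws. ?E ws (\<lambda>qs. \<psi> is qs (y is ws)))"
      unfolding Avg_def[of W] length_map len
    proof (intro avg_mono[OF dist_W])
      fix ws assume ws: "ws \<in> words W n" and w_pos: "0 < weight (map leaf_prob is) ws"
      then have lw: "length ws = n" by (simp add: length_words)
      note D = dist_cond[OF len lw]
      have "(?E ws (\<lambda>qs. of_bool (acc qs))) ^ (2 ^ card I)
          \<le> ?E ws (\<lambda>qs. ?E ws (\<lambda>qs'. \<Prod>R\<in>Pow I. of_bool (acc (mix R is qs qs'))))"
        using finite_Q finite_I dist_cond_prob lw len by (intro Avg_box) auto
      also have "\<dots> \<le> ?E ws (\<lambda>qs. ?E ws (\<lambda>qs'. \<psi> is qs qs'))"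
      proof -
        \<comment> \<open>The positive weight of \<open>ws\<close> excludes the default branch of
          \<open>cond_prob\<close>, so lists of positive conditional weight really have the leaves
          \<open>ws\<close>.\<close>
        have leaves_eq: "leaves qs is = ws"
          if "qs \<in> words Q n" "0 < weight (map2 cond_prob is ws) qs" for qs
        proof (rule nth_equalityI)
          have lq: "length qs = n" using that by (simp add: length_words)
          then show "length (leaves qs is) = length ws" by (simp add: len lw)
          fix j assume "j < length (leaves qs is)"
          then have j: "j < n" by (simp add: len lq)
          have "leaf_prob (is ! j) (ws ! j) \<noteq> 0"
            using weight_nonzero_nth[of "map leaf_prob is" ws j] w_pos len lw j by simp
          moreover have "cond_prob (is ! j) (ws ! j) (qs ! j) \<noteq> 0"
            using weight_nonzero_nth[of "map2 cond_prob is ws" qs j] that(2) len lw lq j by simp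
          ultimately show "leaves qs is ! j = ws ! j"
            using j len lq by (auto simp: cond_prob_def leaves_def split: if_splits)
        qed
        have "(\<Prod>R\<in>Pow I. of_bool (acc (mix R is qs qs'))) \<le> \<psi> is qs qs'"
          if "qs \<in> words Q n" "qs' \<in> words Q n" "leaves qs is = leaves qs' is" for qs qs'
        proof (cases "\<forall>R\<subseteq>I. acc (mix R is qs qs')")
          case True
          then have "\<psi> is qs qs' = 1" using consistent[OF "is" that] by (simp add: \<psi>_def)
          then show ?thesis by (simp add: prod_le_1)
        next
          case False
          then have "(\<Prod>R\<in>Pow I. of_bool (acc (mix R is qs qs'))) = (0::real)"
            using finite_I by (intro prod_zero) auto
          then show ?thesis by (simp add: \<psi>_def)
        qed
        moreover have lz: "length (map2 cond_prob is ws) = n" using len lw by simp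
        ultimately show ?thesis
          unfolding Avg_def lz by (intro avg_mono[OF D]) (simp add: leaves_eq)
      qed
      also have "\<dots> = ?E ws (\<lambda>qs'. ?E ws (\<lambda>qs. \<psi> is qs qs'))"
        unfolding Avg_def by (rule avg_swap)
      also have "\<dots> \<le> ?E ws (\<lambda>qs. \<psi> is qs (y is ws))" by (rule y(2)[OF len lw])
      finally show "(?E ws (\<lambda>qs. of_bool (acc qs))) ^ (2 ^ card I) \<le> ?E ws (\<lambda>qs. \<psi> is qs (y is ws))" .
    qed
    also have "\<dots> = Avg Q (replicate n \<mu>) (\<lambda>qs. \<psi> is qs (y is (leaves qs is)))"
      using Avg_disintegration[OF sub, of "\<lambda>ws qs. \<psi> is qs (y is ws)"] len by simp
    also have "\<dots> = Avg Q (replicate n \<mu>) (\<lambda>qs. of_bool (projs qs is (g (leaves qs is)) = d qs))"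
      unfolding Avg_def by (intro avg_cong) (simp add: \<psi>_def g_leaves "is")
    finally show ?thesis .
  qed
  have "?v ^ (2 ^ card I) = Avg I (replicate n \<nu>) (\<lambda>is. ?v ^ (2 ^ card I))"
    unfolding Avg_def[of I] by (simp add: avg_const dist_Is)
  also have "\<dots> \<le> Avg I (replicate n \<nu>) (\<lambda>is.
      Avg Q (replicate n \<mu>) (\<lambda>qs. of_bool (projs qs is (g (leaves qs is)) = d qs)))"
    unfolding Avg_def[of I] length_replicate by (intro avg_mono[OF dist_Is] main)
  also have "\<dots> = Avg Q (replicate n \<mu>) (\<lambda>qs. votes n g qs (d qs))"
    unfolding votes_def Avg_def by (rule avg_swap)
  finally show ?thesis using that g by blast
qed

end

section \<open>Independent sampling as a weighted average\<close>

lemma pmf_iid: "length qs = n \<Longrightarrow> pmf (iid_pmf p n) qs = weight (replicate n (pmf p)) qs"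
proof (induction n arbitrary: qs)
  case (Suc n)
  then obtain x xs where qs: "qs = x # xs" "length xs = n" by (auto simp: length_Suc_conv)
  have "iid_pmf p (Suc n) = map_pmf (\<lambda>(x, xs). x # xs) (pair_pmf p (iid_pmf p n))"
    by (simp add: pair_pmf_def map_bind_pmf map_pmf_def bind_assoc_pmf bind_return_pmf)
  moreover have "inj (\<lambda>(x, xs). x # xs :: 'a list)" by (auto simp: inj_def)
  ultimately have "pmf (iid_pmf p (Suc n)) (x # xs) = pmf (pair_pmf p (iid_pmf p n)) (x, xs)"
    using pmf_map_inj'[of "\<lambda>(x, xs). x # xs" "pair_pmf p (iid_pmf p n)" "(x, xs)"] by simp
  then show ?case using Suc.IH qs by (simp add: pmf_pair)
qed simp

lemma set_pmf_iid: "set_pmf (iid_pmf p n) \<subseteq> words (set_pmf p) n"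
  by (induction n) auto

lemma prob_iid:
  assumes "finite (set_pmf p)"
  shows "measure_pmf.prob (iid_pmf p n) X
    = Avg (set_pmf p) (replicate n (pmf p)) (\<lambda>qs. of_bool (qs \<in> X))"
proof -
  have "measure_pmf.prob (iid_pmf p n) X = (\<integral>qs. indicat_real X qs \<partial>measure_pmf (iid_pmf p n))"
    by simp
  also have "\<dots> = (\<Sum>qs\<in>words (set_pmf p) n. indicat_real X qs * pmf (iid_pmf p n) qs)"
    using assms set_pmf_iid by (intro integral_measure_pmf_real) auto
  also have "\<dots> = Avg (set_pmf p) (replicate n (pmf p)) (\<lambda>qs. of_bool (qs \<in> X))"
    unfolding Avg_def avg_def by (intro sum.cong) (auto simp: pmf_iid length_words indicator_def)
  finally show ?thesis .
qed

lemma is_dist_pmf: "finite (set_pmf p) \<Longrightarrow> is_dist (set_pmf p) (pmf p)"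
  by (simp add: is_dist_def sum_pmf_eq_1)

text \<open>If all mixtures of \<open>qs\<close> and \<open>qs'\<close> are accepted, exchanging the coordinates of colour \<open>r\<close>
  changes neither the question of player \<open>r\<close> nor the question tuple in coordinate \<open>j\<close> (of another
  colour), hence not the label in coordinate \<open>j\<close>, which any single player determines.\<close>

lemma label_of_resampled_answer:
  fixes \<alpha> :: "nat \<Rightarrow> 'x list \<Rightarrow> 'a list"
  assumes len: "length is = n" "length qs = n" "length qs' = n"
    and I: "finite I" "set is \<subseteq> I"
    and agree: "\<And>j. j < n \<Longrightarrow> qs ! j ! (is ! j) = qs' ! j ! (is ! j)"
    and acc: "\<And>R j i i'. R \<subseteq> I \<Longrightarrow> j < n \<Longrightarrow> i \<in> I \<Longrightarrow> i' \<in> I \<Longrightarrow>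
      lab (mix R is qs qs' ! j) i (\<alpha> i (map (\<lambda>q. q ! i) (mix R is qs qs')) ! j)
      = lab (mix R is qs qs' ! j) i' (\<alpha> i' (map (\<lambda>q. q ! i') (mix R is qs qs')) ! j)"
    and j: "j < n" and i: "i \<in> I"
  shows "lab (qs ! j) (is ! j) (\<alpha> (is ! j) (map (\<lambda>q. q ! (is ! j)) qs') ! j)
    = lab (qs ! j) i (\<alpha> i (map (\<lambda>q. q ! i) qs) ! j)"
proof -
  define l where "l = is ! j"
  have l: "l \<in> I" using I len j by (auto simp: l_def)
  have mix_empty: "mix {} is qs qs' = qs" using len by (intro nth_equalityI) auto
  \<comment> \<open>Induction on the set of colours already taken from \<open>qs'\<close>, with the
    colour \<open>l\<close> of coordinate \<open>j\<close> left alone.\<close>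
  have "R \<subseteq> I - {l} \<longrightarrow> (\<forall>i'\<in>I. lab (qs ! j) i' (\<alpha> i' (map (\<lambda>q. q ! i') (mix R is qs qs')) ! j)
      = lab (qs ! j) i (\<alpha> i (map (\<lambda>q. q ! i) qs) ! j))" if "finite R" for R
    using that
  proof (induction R rule: finite_induct)
    case empty
    show ?case unfolding mix_empty
      by (intro impI ballI acc[of "{}", unfolded mix_empty, OF _ j _ i]) auto
  next
    case (insert r R)
    show ?case
    proof (intro impI ballI)
      assume sub: "insert r R \<subseteq> I - {l}"
      fix i' assume i': "i' \<in> I"
      have r: "r \<in> I" using sub by auto
      have nth: "mix (insert r R) is qs qs' ! j = qs ! j"
        using sub len j by (simp add: l_def[symmetric]) auto
      have col: "map (\<lambda>q. q ! r) (mix (insert r R) is qs qs') = map (\<lambda>q. q ! r) (mix R is qs qs')"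
        using len agree by (intro nth_equalityI) auto
      \<comment> \<open>Player \<open>r\<close> is the pivot: the answers of \<open>r\<close> are
        unchanged, and acceptance carries the label over to every other player.\<close>
      have "lab (qs ! j) i' (\<alpha> i' (map (\<lambda>q. q ! i') (mix (insert r R) is qs qs')) ! j)
          = lab (qs ! j) r (\<alpha> r (map (\<lambda>q. q ! r) (mix (insert r R) is qs qs')) ! j)"
        using acc[OF _ j i' r, of "insert r R"] sub unfolding nth by (simp add: subset_Diff_insert)
      then show "lab (qs ! j) i' (\<alpha> i' (map (\<lambda>q. q ! i') (mix (insert r R) is qs qs')) ! j)
          = lab (qs ! j) i (\<alpha> i (map (\<lambda>q. q ! i) qs) ! j)"
        unfolding col using insert.IH[THEN mp, THEN bspec, OF _ r] sub by simp
    qed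
  qed
  from this[of "I - {l}", THEN mp, THEN bspec, OF _ _ l]
  have "lab (qs ! j) l (\<alpha> l (map (\<lambda>q. q ! l) (mix (I - {l}) is qs qs')) ! j)
      = lab (qs ! j) i (\<alpha> i (map (\<lambda>q. q ! i) qs) ! j)"
    using I by simp
  \<comment> \<open>In the coordinates of colour \<open>l\<close> both lists have the same entry for
    player \<open>l\<close>, who therefore sees exactly the questions of \<open>qs'\<close>.\<close>
  moreover have "map (\<lambda>q. q ! l) (mix (I - {l}) is qs qs') = map (\<lambda>q. q ! l) qs'"
    using len agree I by (intro nth_equalityI) (auto simp: subset_iff in_set_conv_nth)
  ultimately show ?thesis by (simp add: l_def)
qed

section \<open>Exponential decay for the repeated k-player game\<close>

lemma win_prob_le_1: "win_prob G \<alpha> \<le> 1"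
  by (simp add: win_prob_def)

lemma win_prob_le_val: "\<alpha> \<in> strategies G \<Longrightarrow> win_prob G \<alpha> \<le> val G"
  unfolding val_def by (intro cSUP_upper bdd_aboveI[of _ 1]) (auto simp: win_prob_le_1)

theorem theorem1p2:
  fixes G :: "('x, 'a) game" and \<epsilon> :: real
  assumes "nplayers G \<ge> 2"
    and "wf_game G"
    and "projection_game G"
    and "\<epsilon> > 0"
    and "val G = 1 - \<epsilon>"
  shows "\<exists>c>0. \<forall>n\<ge>1. val (par_rep G n) \<le> exp (- c * real n)"
proof -
  define k where "k = nplayers G"
  define Q where "Q = set_pmf (qdist G)"
  define I where "I = {..<k}"
  define B where "B = (\<Union>i\<in>I. aset G i)"
  have k: "2 \<le> k" using assms(1) by (simp add: k_def)
  have fin: "finite (qset G i)" "finite (aset G i)" "aset G i \<noteq> {}" if "i < k" for i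
    using assms(2) that by (auto simp: wf_game_def k_def)
  have Q_sub: "Q \<subseteq> qtuples G" using assms(2) by (simp add: wf_game_def Q_def)
  have Q_len: "length q = k" and Q_nth: "\<And>i. i < k \<Longrightarrow> q ! i \<in> qset G i" if "q \<in> Q" for q
    using Q_sub that by (auto simp: qtuples_def k_def)
  have "finite (words (\<Union>i\<in>I. qset G i) k)" using fin by (intro finite_words) (auto simp: I_def)
  moreover have "Q \<subseteq> words (\<Union>i\<in>I. qset G i) k"
    using Q_len Q_nth by (auto intro!: words_nthI simp: I_def)
  ultimately have finite_Q: "finite Q" by (rule finite_subset[rotated])
  have "\<exists>\<sigma>. \<forall>q\<in>Q. \<forall>a\<in>atuples G. pred G q a \<longleftrightarrow>
      (\<forall>i<k. \<forall>i'<k. \<sigma> q i (a ! i) = (\<sigma> q i' (a ! i') :: nat))"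
  proof -
    have "\<exists>\<sigma>. \<forall>a\<in>atuples G. pred G q a \<longleftrightarrow> (\<forall>i<k. \<forall>i'<k. \<sigma> i (a ! i) = (\<sigma> i' (a ! i') :: nat))"
      if "q \<in> Q" for q
    proof -
      have irrefl: "(\<forall>i<k. \<forall>i'<k. i \<noteq> i' \<longrightarrow> f i = f i') \<longleftrightarrow> (\<forall>i<k. \<forall>i'<k. f i = f i')" for f :: "nat \<Rightarrow> nat"
        by metis
      show ?thesis
        using bspec[OF assms(3)[unfolded projection_game_def] subsetD[OF Q_sub that]]
        unfolding k_def[symmetric] irrefl by (elim exE conjE) (rule exI)
    qed
    then show ?thesis by (intro bchoice) blast
  qed
  then obtain \<sigma> :: "'x list \<Rightarrow> nat \<Rightarrow> 'a \<Rightarrow> nat" where \<sigma>: "\<And>q a. q \<in> Q \<Longrightarrow> a \<in> atuples G \<Longrightarrow>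
      pred G q a \<longleftrightarrow> (\<forall>i<k. \<forall>i'<k. \<sigma> q i (a ! i) = \<sigma> q i' (a ! i'))" by blast
  \<comment> \<open>The labels \<open>Inr i\<close> make answers that are illegal for player \<open>i\<close> inconsistent with everything
    the other players may say.\<close>
  define lab where "lab q i a = (if a \<in> aset G i then Inl (\<sigma> q i a) else Inr i)"
    for q :: "'x list" and i a
  \<comment> \<open>The tag \<open>i\<close> tells the second player whom to impersonate.\<close>
  define leaf where "leaf q i = (i, q ! i)" for q :: "'x list" and i :: nat
  define D where "D = (\<lambda>(q, i, a). lab q i a) ` (Q \<times> I \<times> B)"
  have lab_D: "lab q i a \<in> D" if "q \<in> Q" "i \<in> I" "a \<in> B" for q i a
    unfolding D_def using that by (intro image_eqI[of _ _ "(q, i, a)"]) auto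
  have finite_B: "finite B" using fin by (auto simp: B_def I_def)
  have aset_B: "aset G i \<subseteq> B" if "i \<in> I" for i using that by (auto simp: B_def)
  have I0: "0 \<in> I" using k by (simp add: I_def)
  interpret projection_system Q I B D "pmf (qdist G)" "\<lambda>_. 1 / real k" leaf lab
  proof
    show "is_dist Q (pmf (qdist G))" unfolding Q_def by (rule is_dist_pmf) (use finite_Q Q_def in simp)
    show "is_dist I (\<lambda>_. 1 / real k)" using k by (simp add: is_dist_def I_def)
    show "B \<noteq> {}" using fin(3)[of 0] k aset_B[OF I0] by auto
    show "finite D" unfolding D_def using finite_Q finite_B by (simp add: I_def)
  qed (use finite_B lab_D k in \<open>auto simp: Q_def pmf_positive\<close>)
  have pred_iff: "pred G q a \<longleftrightarrow> (\<forall>i\<in>I. \<forall>i'\<in>I. lab q i (a ! i) = lab q i' (a ! i'))"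
    if "q \<in> Q" "a \<in> atuples G" for q a
    using \<sigma>[OF that] that(2) by (auto simp: lab_def I_def atuples_def k_def)
  \<comment> \<open>A satisfying assignment would be a perfect strategy for \<open>G\<close>,
    contradicting \<open>val G = 1 - \<epsilon>\<close>.\<close>
  have unsat: "\<nexists>\<beta>. (\<forall>w. \<beta> w \<in> B) \<and> (\<forall>q\<in>Q. satisfies \<beta> q)"
  proof
    assume "\<exists>\<beta>. (\<forall>w. \<beta> w \<in> B) \<and> (\<forall>q\<in>Q. satisfies \<beta> q)"
    then obtain \<beta> where \<beta>: "\<forall>q\<in>Q. satisfies \<beta> q" by blast
    define \<alpha> where "\<alpha> i x = (if \<beta> (i, x) \<in> aset G i then \<beta> (i, x) else (SOME a. a \<in> aset G i))" for i x
    have \<alpha>_in: "\<alpha> i x \<in> aset G i" if "i < k" for i x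
      using fin(3)[OF that] by (auto simp: \<alpha>_def some_in_eq)
    have "pred G q (map (\<lambda>i. \<alpha> i (q ! i)) [0..<k])" if q: "q \<in> Q" for q
    proof -
      have eq: "lab q i (\<beta> (i, q ! i)) = lab q i' (\<beta> (i', q ! i'))" if "i \<in> I" "i' \<in> I" for i i'
        using bspec[OF \<beta> q] that unfolding satisfies_def leaf_def by blast
      have "\<beta> (i, q ! i) \<in> aset G i" if i: "i \<in> I" for i
      proof -
        \<comment> \<open>Another player exists because \<open>k\<close> is at least 2. An illegal
          answer of \<open>i\<close> has the label \<open>Inr i\<close>, which no answer of
          \<open>i'\<close> can match.\<close>
        define i' where "i' = (if i = 0 then 1 else 0 :: nat)"
        have "i' \<in> I" "i' \<noteq> i" using k by (auto simp: I_def i'_def)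
        then show ?thesis using eq[OF i \<open>i' \<in> I\<close>] by (auto simp: lab_def split: if_splits)
      qed
      then have \<alpha>_eq: "\<alpha> i (q ! i) = \<beta> (i, q ! i)" if "i \<in> I" for i using that by (simp add: \<alpha>_def)
      have "map (\<lambda>i. \<alpha> i (q ! i)) [0..<k] \<in> atuples G"
        using \<alpha>_in by (simp add: atuples_def k_def)
      then show ?thesis
        unfolding pred_iff[OF q \<open>map _ _ \<in> atuples G\<close>]
      proof (intro ballI)
        fix i i' assume i: "i \<in> I" "i' \<in> I"
        then show "lab q i (map (\<lambda>i. \<alpha> i (q ! i)) [0..<k] ! i) = lab q i' (map (\<lambda>i. \<alpha> i (q ! i)) [0..<k] ! i')"
          using eq[OF i] \<alpha>_eq[OF i(1)] \<alpha>_eq[OF i(2)] by (simp add: I_def)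
      qed
    qed
    then have "win_prob G \<alpha> = 1"
      unfolding win_prob_def k_def[symmetric]
      by (subst measure_pmf.prob_eq_1) (auto simp: AE_measure_pmf_iff Q_def)
    moreover have "\<alpha> \<in> strategies G" using \<alpha>_in by (simp add: strategies_def k_def)
    ultimately show False using win_prob_le_val[of \<alpha> G] assms(4,5) by simp
  qed
  obtain s where s: "0 \<le> s" "s < 1" "\<forall>n g d. (\<forall>ws. length ws = n \<longrightarrow> g ws \<in> words B n) \<longrightarrow>
      (\<forall>qs\<in>words Q n. d qs \<in> words D n) \<longrightarrow>
      (Avg Q (replicate n (pmf (qdist G))) (\<lambda>qs. votes n g qs (d qs)))\<^sup>2 \<le> s ^ n"
    using agreement_exponential_decay[OF unsat] by (elim exE conjE) (rule that)
  \<comment> \<open>The box inequality costs the exponent \<open>2 ^ k\<close>, the passage from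
    agreement to collisions a further square.\<close>
  define N :: nat where "N = 2 ^ k * 2"
  have win: "(win_prob (par_rep G n) \<alpha>) ^ N \<le> s ^ n" if \<alpha>: "\<alpha> \<in> strategies (par_rep G n)" for n \<alpha>
  proof -
    have \<alpha>_in: "\<alpha> i (map (\<lambda>q. q ! i) qs) \<in> words (aset G i) n" if "i \<in> I" "qs \<in> words Q n" for i qs
    proof -
      have "map (\<lambda>q. q ! i) qs \<in> words (qset G i) n" using that Q_nth by (auto simp: words_def I_def)
      then show ?thesis using \<alpha> that(1) by (simp add: strategies_def par_rep_def words_def I_def k_def)
    qed
    \<comment> \<open>Acceptance in terms of labels; for lists over \<open>Q\<close> it coincides
      with the predicate of the repeated game, since the answers of \<alpha> are legal.\<close>
    define acc where "acc qs \<longleftrightarrow> (\<forall>j<n. \<forall>i\<in>I. \<forall>i'\<in>I.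
      lab (qs ! j) i (\<alpha> i (map (\<lambda>q. q ! i) qs) ! j) = lab (qs ! j) i' (\<alpha> i' (map (\<lambda>q. q ! i') qs) ! j))" for qs
    define b where "b is qs = map (\<lambda>j. \<alpha> (is ! j) (map (\<lambda>q. q ! (is ! j)) qs) ! j) [0..<n]" for "is" qs
    \<comment> \<open>Player 0 can speak for everyone: in an accepted list all players produce the
      same labels.\<close>
    define d where "d qs = map (\<lambda>j. lab (qs ! j) 0 (\<alpha> 0 (map (\<lambda>q. q ! 0) qs) ! j)) [0..<n]" for qs
    have b: "b is qs \<in> words B n" if "is \<in> words I n" "qs \<in> words Q n" for "is" qs
    proof (rule words_nthI)
      fix j assume j: "j < n"
      then have "is ! j \<in> I" using that nth_words by metis
      then show "b is qs ! j \<in> B"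
        using nth_words[OF \<alpha>_in[OF _ that(2)] j] aset_B j by (auto simp: b_def)
    qed (simp add: b_def)
    have d: "d qs \<in> words D n" if "qs \<in> words Q n" for qs
    proof (rule words_nthI)
      fix j assume j: "j < n"
      have "\<alpha> 0 (map (\<lambda>q. q ! 0) qs) ! j \<in> B"
        using nth_words[OF \<alpha>_in[OF I0 that] j] aset_B[OF I0] by auto
      then show "d qs ! j \<in> D" using lab_D[OF nth_words[OF that j] I0] j by (simp add: d_def)
    qed (simp add: d_def)
    have consistent: "projs qs is (b is qs') = d qs"
      if "is": "is \<in> words I n" and qs: "qs \<in> words Q n" and qs': "qs' \<in> words Q n"
        and eq: "leaves qs is = leaves qs' is" and mixed: "\<And>R. R \<subseteq> I \<Longrightarrow> acc (mix R is qs qs')" for "is" qs qs'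
    proof -
      have len: "length is = n" "length qs = n" "length qs' = n"
        using "is" qs qs' by (auto simp: length_words)
      have agree: "qs ! j ! (is ! j) = qs' ! j ! (is ! j)" if "j < n" for j
        using arg_cong[OF eq, of "\<lambda>ws. ws ! j"] that len by (simp add: leaves_def leaf_def)
      show ?thesis
      proof (rule nth_equalityI)
        show "length (projs qs is (b is qs')) = length (d qs)"
          using len by (simp add: projs_def b_def d_def)
        fix j assume "j < length (projs qs is (b is qs'))"
        then have j: "j < n" using len by (simp add: projs_def)
        have "lab (qs ! j) (is ! j) (\<alpha> (is ! j) (map (\<lambda>q. q ! (is ! j)) qs') ! j)
            = lab (qs ! j) 0 (\<alpha> 0 (map (\<lambda>q. q ! 0) qs) ! j)"
        proof (rule label_of_resampled_answer[OF len finite_I _ agree _ j I0])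
          show "set is \<subseteq> I" using "is" by (simp add: words_def)
        qed (assumption | rule mixed[unfolded acc_def, rule_format])+
        then show "projs qs is (b is qs') ! j = d qs ! j"
          using j len by (simp add: projs_def b_def d_def)
      qed
    qed
    let ?v = "Avg Q (replicate n (pmf (qdist G))) (\<lambda>qs. of_bool (acc qs))"
    obtain g where g: "\<And>ws. length ws = n \<Longrightarrow> g ws \<in> words B n"
      "?v ^ (2 ^ card I) \<le> Avg Q (replicate n (pmf (qdist G))) (\<lambda>qs. votes n g qs (d qs))"
      using resampling_strategy[of fst n acc b d] consistent b by (auto simp: leaf_def)
    have "win_prob (par_rep G n) \<alpha> = ?v"
    proof -
      have acc_iff: "acc qs \<longleftrightarrow> (\<forall>j<n. pred G (map (\<lambda>i. qs ! j ! i) [0..<k])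
          (map (\<lambda>i. \<alpha> i (map (\<lambda>j. qs ! j ! i) [0..<n]) ! j) [0..<k]))" if qs: "qs \<in> words Q n" for qs
      proof -
        have col: "map (\<lambda>j. qs ! j ! i) [0..<n] = map (\<lambda>q. q ! i) qs" for i
          using qs by (intro nth_equalityI) (auto simp: length_words)
        have row: "map (\<lambda>i. qs ! j ! i) [0..<k] = qs ! j" if "j < n" for j
          using Q_len[OF nth_words[OF qs that]] by (intro nth_equalityI) auto
        have "map (\<lambda>i. \<alpha> i (map (\<lambda>q. q ! i) qs) ! j) [0..<k] \<in> atuples G" if "j < n" for j
          using nth_words[OF \<alpha>_in[OF _ qs] that] by (simp add: atuples_def I_def k_def)
        then show ?thesis
          unfolding acc_def col using row pred_iff nth_words[OF qs] by (simp add: I_def)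
      qed
      have row: "map (\<lambda>i. map (\<lambda>i. map (\<lambda>j. qs ! j ! i) [0..<n]) [0..<k] ! i ! j) [0..<k]
          = map (\<lambda>i. qs ! j ! i) [0..<k]" if "j < n" for qs :: "'x list list" and j
        using that by (intro map_cong refl) simp
      have answers: "map (\<lambda>i. map (\<lambda>i. \<alpha> i (map (\<lambda>i. map (\<lambda>j. qs ! j ! i) [0..<n]) [0..<k] ! i)) [0..<k] ! i ! j) [0..<k]
          = map (\<lambda>i. \<alpha> i (map (\<lambda>j. qs ! j ! i) [0..<n]) ! j) [0..<k]" for qs :: "'x list list" and j
        by (intro map_cong refl) simp
      have "win_prob (par_rep G n) \<alpha> = measure_pmf.prob (iid_pmf (qdist G) n)
         {qs. \<forall>j<n. pred G (map (\<lambda>i. qs ! j ! i) [0..<k])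
          (map (\<lambda>i. \<alpha> i (map (\<lambda>j. qs ! j ! i) [0..<n]) ! j) [0..<k])}"
        unfolding win_prob_def par_rep_def k_def[symmetric]
        by (simp add: vimage_def row answers)
      also have "\<dots> = ?v"
        using finite_Q prob_iid[of "qdist G"] acc_iff unfolding Q_def[symmetric]
        by (auto simp: Avg_def intro!: avg_cong)
      finally show ?thesis .
    qed
    moreover have "?v ^ N \<le> (Avg Q (replicate n (pmf (qdist G))) (\<lambda>qs. votes n g qs (d qs)))\<^sup>2"
      unfolding N_def power_mult using g(2) 
      by (intro power_mono) (auto simp: I_def Avg_def intro!: zero_le_power avg_nonneg dist_Qs)
    ultimately show ?thesis using s(3)[rule_format, of n g d] g(1) d by (auto intro: order_trans)
  qed
  \<comment> \<open>The bound 1/2 keeps \<open>t\<close> positive when \<open>s = 0\<close>, so that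
    \<open>- ln t\<close> is a usable rate; dividing by \<open>N\<close> accounts for the root taken
    at the end.\<close>
  define t where "t = max s (1 / 2)"
  define c where "c = - ln t / real N"
  have t: "0 < t" "t < 1" "s \<le> t" using s by (auto simp: t_def)
  have N: "0 < N" by (simp add: N_def)
  have "0 < c" using t N by (simp add: c_def divide_neg_pos)
  moreover have "val (par_rep G n) \<le> exp (- c * real n)" for n
  proof -
    have "strategies (par_rep G n) \<noteq> {}"
    proof -
      have "(\<lambda>i _. replicate n (SOME a. a \<in> aset G i)) \<in> strategies (par_rep G n)"
        using fin(3) by (auto simp: strategies_def par_rep_def k_def some_in_eq)
      then show ?thesis by blast
    qed
    moreover have "win_prob (par_rep G n) \<alpha> \<le> exp (- c * real n)"
      if "\<alpha> \<in> strategies (par_rep G n)" for \<alpha>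
    proof -
      have "(win_prob (par_rep G n) \<alpha>) ^ N \<le> t ^ n"
        using win[OF that] power_mono[OF t(3) s(1), of n] by simp
      also have "t ^ n = exp (ln t) ^ n" using t by simp
      also have "\<dots> = exp (- c * real n) ^ N"
        using N unfolding exp_of_nat_mult[symmetric] by (simp add: c_def)
      finally show ?thesis
        using N by (subst (asm) power_mono_iff) (auto simp: win_prob_def)
    qed
    ultimately show ?thesis unfolding val_def by (rule cSUP_least)
  qed
  ultimately show ?thesis by blast
qed

end
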